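(* Let $\mathfrak g$ be a finite-dimensional simple complex Lie algebra, $\sigma$ an automorphism of $\mathfrak g$ of order $T$, $k\in\mathbf C$ with $k\neq -h^\vee$, and $M$ a restricted $\tilde{\mathfrak g}[\sigma]$-module of level $k$, regarded as a weak $\sigma$-twisted $N(k\Lambda_0)$-module $(M,Y_M^\sigma)$. Let $R\subset N(k\Lambda_0)$ be a subspace invariant under $\sigma$, under $\mathfrak g=\mathfrak g(0)$ and under $L(0)$, and let $\bar R_\sigma=\mathbf C\text{-span}\{r_n\mid r\in R,\ n\in\frac1T\mathbf Z\}\subset\operatorname{End}M$, where $Y_M^\sigma(r,z)=\sum_{n\in\frac1T\mathbf Z}r_nz^{-n-1}$. (i) Assume that $\mathfrak g(n)R=0$ for all $n\in\mathbf Z_{>0}$. Then $$[x(m),r_n]=(x(0)r)_{m+n}\qquad( * )$$ for all $m,n\in\frac1T\mathbf Z$, $x\in\mathfrak g_{(mT\bmod T)}$ and $r\in R$, so that $\bar R_\sigma$ becomes a loop module under the adjoint action of $\tilde{\mathfrak g}[\sigma]$. Conversely, if $M$ is a faithful weak $\sigma$-twisted $N(k\Lambda_0)$-module and $( * )$ holds, then $\mathfrak g(n)R=0$ for all $n\in\mathbf Z_{>0}$. (ii) $\bar R_\sigma$ is an irreducible loop $\tilde{\mathfrak g}[\sigma]$-module if $R$ is a nontrivial irreducible $\mathfrak g$-module. Moreover, if $M$ is a faithful weak $\sigma$-twisted $N(k\Lambda_0)$-module, then the converse is also true: if $\bar R_\sigma$ is an irreducible loop $\tilde{\mathfrak g}[\sigma]$-module,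 then $R$ is a nontrivial irreducible $\mathfrak g$-module.
   Context: **Affine Lie algebras.** $\langle\cdot,\cdot\rangle$ is the invariant symmetric bilinear form on $\mathfrak g$ normalized so that long roots have square length $2$; $h^\vee$ is the dual Coxeter number of $\mathfrak g$. For an automorphism $\sigma$ of order $T$, $\mathfrak g_{(j)}$ ($j\in\mathbf Z_T$) is the $e^{2\pi i j/T}$-eigenspace of $\sigma$. Set $\hat{\mathfrak g}[\sigma]=\bigoplus_{j=0}^{T-1}\mathfrak g_{(j)}\otimes t^{j/T}\mathbf C[t,t^{-1}]\oplus\mathbf Cc$ and $\tilde{\mathfrak g}[\sigma]=\hat{\mathfrak g}[\sigma]\rtimes\mathbf Cd$, with $c$ central, $[d,a\otimes t^m]=m\,a\otimes t^m$, $[a\otimes t^m,b\otimes t^n]=[a,b]\otimes t^{m+n}+m\delta_{m+n,0}\langle a,b\rangle c$ for $m,n\in\frac1T\mathbf Z$, $a\in\mathfrak g_{(mT\bmod T)}$, $b\in\mathfrak g_{(nT\bmod T)}$. Write $a(m)=a\otimes t^m$ for $a\in\mathfrak g_{(mT\bmod T)}$. For $\sigma=\mathrm{id}$ write $\hat{\mathfrak g},\tilde{\mathfrak g}$, and $\mathfrak g(n)=\mathfrak g\otimes t^n$, $n\in\mathbf Z$. A module $M$ is restricted of level $k$ if for each $v\in M$ one has $(\mathfrak g_{(j)}\otimes t^{n+j/T})v=0$ for all $j$ and all $n\gg0$, and $c$ acts as $k\,\mathrm{id}_M$. **The vertex operator algebra $N(k\Lambda_0)$.** For $k\ne-h^\vee$,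 $N(k\Lambda_0)=U(\tilde{\mathfrak g})\otimes_{U(\tilde{\mathfrak g}_{\ge0})}\mathbf C$, where $\tilde{\mathfrak g}_{\ge0}=\bigoplus_{n\ge0}\mathfrak g(n)\oplus\mathbf Cc\oplus\mathbf Cd$ acts on $\mathbf C$ by $c\cdot1=k$, $d\cdot1=0$, $\mathfrak g(n)\cdot1=0$ ($n\ge0$). With $\mathbf 1=1\otimes1$, it is a VOA with vacuum $\mathbf 1$, with $Y(a(-1)\mathbf 1,z)=\sum_{n\in\mathbf Z}a(n)z^{-n-1}$ for $a\in\mathfrak g$, and with Virasoro element $\omega=\frac1{2(k+h^\vee)}\sum_j a^j(-1)^2\mathbf 1$ ($\{a^j\}$ an orthonormal basis of $\mathfrak g$); $Y(\omega,z)=\sum_nL(n)z^{-n-2}$. In the claim, the elements $x(0)$ and $\mathfrak g(n)$ applied to $R$ act on $N(k\Lambda_0)$ as elements of the untwisted algebra $\hat{\mathfrak g}$. The automorphism $\sigma$ of $\mathfrak g$ induces a VOA automorphism of $N(k\Lambda_0)$, again denoted $\sigma$. **Twisted modules.** Let $V$ be a VOA with automorphism $\sigma$ of order $T$, $V^j$ its $e^{2\pi ij/T}$-eigenspace. A weak $\sigma$-twisted $V$-module is a vector space $M$ with a linear map $Y_M:V\to(\operatorname{End}M)[[z^{1/T},z^{-1/T}]]$ such that $Y_M(a,z)w$ has only finitely many negative powers of $z$ for all $a\in V$, $w\in M$; $Y_M(\mathbf 1,z)=\mathrm{id}_M$; $z^{j/T}Y_M(a,z)\in(\operatorname{End}M)[[z,z^{-1}]]$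 for $a\in V^j$, $0\le j\le T-1$; and for $a\in V^j$, $b\in V$ the twisted Jacobi identity holds: $z_0^{-1}\delta(\frac{z_1-z_2}{z_0})Y_M(a,z_1)Y_M(b,z_2)-z_0^{-1}\delta(\frac{-z_2+z_1}{z_0})Y_M(b,z_2)Y_M(a,z_1)=z_2^{-1}(\frac{z_1-z_0}{z_2})^{-j/T}\delta(\frac{z_1-z_0}{z_2})Y_M(Y(a,z_0)b,z_2)$. It is known (Li) that a restricted $\hat{\mathfrak g}[\sigma]$-module $M$ of level $k\ne-h^\vee$ has a unique structure $(M,Y_M^\sigma)$ of weak $\sigma$-twisted $N(k\Lambda_0)$-module with $Y_M^\sigma(a(-1)\mathbf 1,z)=\sum_{n\in\mathbf Z}a(n+j/T)z^{-n-j/T-1}$ for $a\in\mathfrak g_{(j)}$. It is called faithful if $Y_M^\sigma(v,z)=0$ implies $v=0$. **Loop modules.** On $M$ put $L(0)=\operatorname{Res}_z zY_M^\sigma(\omega,z)$. The adjoint action of $\tilde{\mathfrak g}[\sigma]$ on $\bar R_\sigma$ is the action by commutators in $\operatorname{End}M$ of (the image of) $\hat{\mathfrak g}[\sigma]$ and of $L(0)$ (one identifies $\tilde{\mathfrak g}[\sigma]$ with $\hat{\mathfrak g}[\sigma]\rtimes\mathbf CL(0)$; $d$ corresponds to $-L(0)$). That $\bar R_\sigma$ is a loop module means that it is stable under this action, with $x(m)$ acting by formula $( * )$ (and $c$ acting by $0$). A nontrivial irreducible $\mathfrak g$-module is an irreducible $\mathfrak g$-module which is not the one-dimensional trivial 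module.
   Formalization: In (ii), the first claim assumes g(n)R=0 for n>0 and R̄_σ≠0; in the converse R̄_σ must be a nontrivial module, and R is shown nontrivial and irreducible under g together with σ, hence irreducible under g if all g-submodules of R are σ-invariant (the literal claim fails for outer σ). *)

theory Defs
  imports
    Complex_Main
    "HOL-Library.Poly_Mapping"
    "HOL-Library.Groups_Big_Fun"
    "HOL-Library.Function_Algebras"
    "HOL-Library.Product_Plus"
begin

text \<open>
  Complex vector spaces are types of class \<^class>\<open>ab_group_add\<close> with an explicit scalar
  multiplication satisfying \<^const>\<open>vector_space\<close>.  Operators are plain functions, added pointwise
  (\<open>Function_Algebras\<close>); the pointwise product of functions is never used.
\<close>

section \<open>Linear algebra\<close>

definition finite_dim :: "(complex \<Rightarrow> 'a::ab_group_add \<Rightarrow> 'a) \<Rightarrow> 'a set \<Rightarrow> bool" where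
  "finite_dim s U \<longleftrightarrow> (\<exists>B. finite B \<and> U \<subseteq> module.span s B)"

definition eigenspace :: "(complex \<Rightarrow> 'a::ab_group_add \<Rightarrow> 'a) \<Rightarrow> ('a \<Rightarrow> 'a) \<Rightarrow> complex \<Rightarrow> 'a set" where
  "eigenspace s f c = {x. f x = s c x}"

definition op_scale :: "(complex \<Rightarrow> 'a \<Rightarrow> 'a) \<Rightarrow> complex \<Rightarrow> ('a \<Rightarrow> 'a) \<Rightarrow> 'a \<Rightarrow> 'a" where
  "op_scale s c u = (\<lambda>v. s c (u v))"

definition commutator :: "('a::ab_group_add \<Rightarrow> 'a) \<Rightarrow> ('a \<Rightarrow> 'a) \<Rightarrow> 'a \<Rightarrow> 'a" where
  "commutator f g = (\<lambda>v. f (g v) - g (f v))"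

definition has_order :: "('a \<Rightarrow> 'a) \<Rightarrow> nat \<Rightarrow> bool" where
  "has_order f T \<longleftrightarrow> 0 < T \<and> f ^^ T = id \<and> (\<forall>t. 0 < t \<and> t < T \<longrightarrow> f ^^ t \<noteq> id)"

definition stable_under :: "('a \<Rightarrow> 'a) set \<Rightarrow> 'a set \<Rightarrow> bool" where
  "stable_under Ops W \<longleftrightarrow> (\<forall>f\<in>Ops. f ` W \<subseteq> W)"

definition irreducible_under ::
  "(complex \<Rightarrow> 'a::ab_group_add \<Rightarrow> 'a) \<Rightarrow> ('a \<Rightarrow> 'a) set \<Rightarrow> 'a set \<Rightarrow> bool" where
  "irreducible_under s Ops W \<longleftrightarrow>
     module.subspace s W \<and> stable_under Ops W \<and> W \<noteq> {0} \<and>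
     (\<forall>U. module.subspace s U \<and> U \<subseteq> W \<and> stable_under Ops U \<longrightarrow> U = {0} \<or> U = W)"

definition acts_nontrivially :: "('a::zero \<Rightarrow> 'a) set \<Rightarrow> 'a set \<Rightarrow> bool" where
  "acts_nontrivially Ops W \<longleftrightarrow> (\<exists>f\<in>Ops. \<exists>w\<in>W. f w \<noteq> 0)"

text \<open>An irreducible module on which all operators vanish is one-dimensional and trivial.\<close>

definition nontrivial_irreducible_under ::
  "(complex \<Rightarrow> 'a::ab_group_add \<Rightarrow> 'a) \<Rightarrow> ('a \<Rightarrow> 'a) set \<Rightarrow> 'a set \<Rightarrow> bool" where
  "nontrivial_irreducible_under s Ops W \<longleftrightarrow>
     irreducible_under s Ops W \<and> acts_nontrivially Ops W"


section \<open>Simple Lie algebras\<close>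

definition lie_algebra :: "(complex \<Rightarrow> 'g::ab_group_add \<Rightarrow> 'g) \<Rightarrow> ('g \<Rightarrow> 'g \<Rightarrow> 'g) \<Rightarrow> bool" where
  "lie_algebra s br \<longleftrightarrow>
     vector_space s \<and>
     (\<forall>x. Vector_Spaces.linear s s (br x)) \<and>
     (\<forall>y. Vector_Spaces.linear s s (\<lambda>x. br x y)) \<and>
     (\<forall>x. br x x = 0) \<and>
     (\<forall>x y z. br x (br y z) + br y (br z x) + br z (br x y) = 0)"

definition simple_lie_algebra :: "(complex \<Rightarrow> 'g::ab_group_add \<Rightarrow> 'g) \<Rightarrow> ('g \<Rightarrow> 'g \<Rightarrow> 'g) \<Rightarrow> bool" where
  "simple_lie_algebra s br \<longleftrightarrow>
     lie_algebra s br \<and> finite_dim s UNIV \<and> (\<exists>x y. br x y \<noteq> 0) \<and>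
     (\<forall>I. module.subspace s I \<and> (\<forall>x. \<forall>y\<in>I. br x y \<in> I) \<longrightarrow> I = {0} \<or> I = UNIV)"

definition lie_automorphism ::
  "(complex \<Rightarrow> 'g::ab_group_add \<Rightarrow> 'g) \<Rightarrow> ('g \<Rightarrow> 'g \<Rightarrow> 'g) \<Rightarrow> ('g \<Rightarrow> 'g) \<Rightarrow> bool" where
  "lie_automorphism s br \<sigma> \<longleftrightarrow>
     Vector_Spaces.linear s s \<sigma> \<and> bij \<sigma> \<and> (\<forall>x y. \<sigma> (br x y) = br (\<sigma> x) (\<sigma> y))"

definition invariant_form ::
  "(complex \<Rightarrow> 'g::ab_group_add \<Rightarrow> 'g) \<Rightarrow> ('g \<Rightarrow> 'g \<Rightarrow> 'g) \<Rightarrow> ('g \<Rightarrow> 'g \<Rightarrow> complex) \<Rightarrow> bool" where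
  "invariant_form s br form \<longleftrightarrow>
     (\<forall>x. Vector_Spaces.linear s (*) (form x)) \<and>
     (\<forall>x y. form x y = form y x) \<and>
     (\<forall>x y z. form (br x y) z = form x (br y z))"

definition cartan_subalgebra ::
  "(complex \<Rightarrow> 'g::ab_group_add \<Rightarrow> 'g) \<Rightarrow> ('g \<Rightarrow> 'g \<Rightarrow> 'g) \<Rightarrow> 'g set \<Rightarrow> bool" where
  "cartan_subalgebra s br H \<longleftrightarrow>
     module.subspace s H \<and>
     (\<forall>x. x \<in> H \<longleftrightarrow> (\<forall>h\<in>H. br h x = 0)) \<and>
     (\<forall>h\<in>H. module.span s (\<Union>c. eigenspace s (br h) c) = UNIV)"

text \<open>
  A root \<open>\<alpha>\<close> is represented by the vector \<open>t\<close> of \<open>H\<close> with \<open>\<alpha>(h) = \<langle>t, h\<rangle>\<close>; the form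
  induced on the dual of \<open>H\<close> is then the given form on these vectors.
\<close>

definition roots ::
  "(complex \<Rightarrow> 'g::ab_group_add \<Rightarrow> 'g) \<Rightarrow> ('g \<Rightarrow> 'g \<Rightarrow> 'g) \<Rightarrow> ('g \<Rightarrow> 'g \<Rightarrow> complex) \<Rightarrow> 'g set \<Rightarrow> 'g set" where
  "roots s br form H =
     {t \<in> H. t \<noteq> 0 \<and> (\<exists>x. x \<noteq> 0 \<and> (\<forall>h\<in>H. br h x = s (form t h) x))}"

definition long_roots_normalized ::
  "(complex \<Rightarrow> 'g::ab_group_add \<Rightarrow> 'g) \<Rightarrow> ('g \<Rightarrow> 'g \<Rightarrow> 'g) \<Rightarrow> ('g \<Rightarrow> 'g \<Rightarrow> complex) \<Rightarrow> 'g set \<Rightarrow> bool" where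
  "long_roots_normalized s br form H \<longleftrightarrow>
     (\<exists>t\<in>roots s br form H. form t t = 2) \<and>
     (\<forall>t\<in>roots s br form H. form t t \<in> \<real> \<and> Re (form t t) \<le> 2)"

definition nonneg_comb :: "(complex \<Rightarrow> 'g::ab_group_add \<Rightarrow> 'g) \<Rightarrow> 'g set \<Rightarrow> 'g set" where
  "nonneg_comb s D = {\<Sum>b\<in>D. s (of_nat (c b)) b | c. True}"

definition root_base ::
  "(complex \<Rightarrow> 'g::ab_group_add \<Rightarrow> 'g) \<Rightarrow> ('g \<Rightarrow> 'g \<Rightarrow> 'g) \<Rightarrow> ('g \<Rightarrow> 'g \<Rightarrow> complex) \<Rightarrow> 'g set \<Rightarrow> 'g set \<Rightarrow> bool" where
  "root_base s br form H D \<longleftrightarrow>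
     finite D \<and> D \<subseteq> roots s br form H \<and> \<not> module.dependent s D \<and>
     (\<forall>t\<in>roots s br form H. t \<in> nonneg_comb s D \<or> - t \<in> nonneg_comb s D)"

definition positive_roots ::
  "(complex \<Rightarrow> 'g::ab_group_add \<Rightarrow> 'g) \<Rightarrow> ('g \<Rightarrow> 'g \<Rightarrow> 'g) \<Rightarrow> ('g \<Rightarrow> 'g \<Rightarrow> complex) \<Rightarrow> 'g set \<Rightarrow> 'g set \<Rightarrow> 'g set" where
  "positive_roots s br form H D = roots s br form H \<inter> nonneg_comb s D"

definition highest_root ::
  "(complex \<Rightarrow> 'g::ab_group_add \<Rightarrow> 'g) \<Rightarrow> ('g \<Rightarrow> 'g \<Rightarrow> 'g) \<Rightarrow> ('g \<Rightarrow> 'g \<Rightarrow> complex) \<Rightarrow> 'g set \<Rightarrow> 'g set \<Rightarrow> 'g" where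
  "highest_root s br form H D =
     (THE t. t \<in> positive_roots s br form H D \<and> (\<forall>a\<in>D. t + a \<notin> roots s br form H))"

text \<open>
  \<open>h\<^sup>\<or> = 1 + \<rho>(\<theta>\<^sup>\<or>)\<close>, where \<open>\<theta>\<close> is the highest root, \<open>\<rho>\<close> is half the sum of the positive roots and
  \<open>\<rho>(\<theta>\<^sup>\<or>) = 2\<langle>\<rho>, \<theta>\<rangle> / \<langle>\<theta>, \<theta>\<rangle>\<close>.
\<close>

definition dual_coxeter ::
  "(complex \<Rightarrow> 'g::ab_group_add \<Rightarrow> 'g) \<Rightarrow> ('g \<Rightarrow> 'g \<Rightarrow> 'g) \<Rightarrow> ('g \<Rightarrow> 'g \<Rightarrow> complex) \<Rightarrow> 'g set \<Rightarrow> 'g set \<Rightarrow> complex" where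
  "dual_coxeter s br form H D =
     (let \<theta> = highest_root s br form H D
      in 1 + (\<Sum>a\<in>positive_roots s br form H D. form a \<theta>) / form \<theta> \<theta>)"

definition orthonormal_basis ::
  "(complex \<Rightarrow> 'g::ab_group_add \<Rightarrow> 'g) \<Rightarrow> ('g \<Rightarrow> 'g \<Rightarrow> complex) \<Rightarrow> 'g set \<Rightarrow> bool" where
  "orthonormal_basis s form B \<longleftrightarrow>
     finite B \<and> module.span s B = UNIV \<and>
     (\<forall>a\<in>B. \<forall>b\<in>B. form a b = (if a = b then 1 else 0))"


section \<open>Affine Lie algebras\<close>

text \<open>
  The triple \<open>(f, \<alpha>, \<beta>)\<close> stands for \<open>\<Sum>\<^sub>m f(m) \<otimes> t\<^sup>m + \<alpha> c + \<beta> d\<close> with rational exponents \<open>m\<close>.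
  All the algebras considered are subspaces of this type, and \<open>aff_bracket\<close> restricts to them.
\<close>

type_synonym 'g affine = "(rat \<Rightarrow>\<^sub>0 'g) \<times> complex \<times> complex"

definition mode :: "'g::zero \<Rightarrow> rat \<Rightarrow> 'g affine" where
  "mode a m = (Poly_Mapping.single m a, 0, 0)"

definition aff_c :: "'g::zero affine" where
  "aff_c = (0, 1, 0)"

definition aff_d :: "'g::zero affine" where
  "aff_d = (0, 0, 1)"

definition aff_scale :: "(complex \<Rightarrow> 'g::zero \<Rightarrow> 'g) \<Rightarrow> complex \<Rightarrow> 'g affine \<Rightarrow> 'g affine" where
  "aff_scale s z X = (case X of (f, \<alpha>, \<beta>) \<Rightarrow> (Poly_Mapping.map (s z) f, z * \<alpha>, z * \<beta>))"

definition aff_bracket ::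
  "(complex \<Rightarrow> 'g::ab_group_add \<Rightarrow> 'g) \<Rightarrow> ('g \<Rightarrow> 'g \<Rightarrow> 'g) \<Rightarrow> ('g \<Rightarrow> 'g \<Rightarrow> complex) \<Rightarrow>
     'g affine \<Rightarrow> 'g affine \<Rightarrow> 'g affine" where
  "aff_bracket s br form X X' = (case (X, X') of ((f, \<alpha>, \<beta>), (f', \<alpha>', \<beta>')) \<Rightarrow>
     ((\<Sum>m\<in>Poly_Mapping.keys f. \<Sum>n\<in>Poly_Mapping.keys f'.
          Poly_Mapping.single (m + n) (br (Poly_Mapping.lookup f m) (Poly_Mapping.lookup f' n)))
      + (\<Sum>n\<in>Poly_Mapping.keys f'.
          Poly_Mapping.single n (s (\<beta> * of_rat n) (Poly_Mapping.lookup f' n)))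
      - (\<Sum>m\<in>Poly_Mapping.keys f.
          Poly_Mapping.single m (s (\<beta>' * of_rat m) (Poly_Mapping.lookup f m))),
      (\<Sum>m\<in>Poly_Mapping.keys f.
          of_rat m * form (Poly_Mapping.lookup f m) (Poly_Mapping.lookup f' (- m))),
      0))"

definition frac_ints :: "nat \<Rightarrow> rat set" where
  "frac_ints T = {m. m * of_nat T \<in> \<int>}"

definition residue :: "nat \<Rightarrow> rat \<Rightarrow> int" where
  "residue T m = \<lfloor>m * of_nat T\<rfloor> mod int T"

definition graded_part ::
  "(complex \<Rightarrow> 'a::ab_group_add \<Rightarrow> 'a) \<Rightarrow> ('a \<Rightarrow> 'a) \<Rightarrow> nat \<Rightarrow> int \<Rightarrow> 'a set" where
  "graded_part s \<sigma> T j = eigenspace s \<sigma> (exp (2 * of_real pi * \<i> * of_int j / of_nat T))"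

text \<open>
  \<open>twisted_affine s \<sigma> T\<close> is \<open>\<gg>~[\<sigma>]\<close> as a subspace, and \<open>twisted_affine s id 1\<close> the untwisted
  algebra \<open>\<gg>~\<close>.
\<close>

definition twisted_affine ::
  "(complex \<Rightarrow> 'g::ab_group_add \<Rightarrow> 'g) \<Rightarrow> ('g \<Rightarrow> 'g) \<Rightarrow> nat \<Rightarrow> 'g affine set" where
  "twisted_affine s \<sigma> T =
     {(f, \<alpha>, \<beta>) | f \<alpha> \<beta>. \<forall>m\<in>Poly_Mapping.keys f.
        m \<in> frac_ints T \<and> Poly_Mapping.lookup f m \<in> graded_part s \<sigma> T (residue T m)}"

definition affine_ge0 :: "'g::zero affine set" where
  "affine_ge0 = {(f, \<alpha>, \<beta>) | f \<alpha> \<beta>. \<forall>m\<in>Poly_Mapping.keys f. m \<in> \<int> \<and> 0 \<le> m}"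


section \<open>Modules over Lie algebras and induced modules\<close>

text \<open>A representation on \<open>'v\<close> of the Lie subalgebra \<open>L\<close> of \<open>'l\<close>; \<open>\<rho>\<close> is irrelevant outside \<open>L\<close>.\<close>

definition lie_module ::
  "(complex \<Rightarrow> 'l::ab_group_add \<Rightarrow> 'l) \<Rightarrow> ('l \<Rightarrow> 'l \<Rightarrow> 'l) \<Rightarrow> 'l set \<Rightarrow>
     (complex \<Rightarrow> 'v::ab_group_add \<Rightarrow> 'v) \<Rightarrow> ('l \<Rightarrow> 'v \<Rightarrow> 'v) \<Rightarrow> bool" where
  "lie_module sl br L sv \<rho> \<longleftrightarrow>
     vector_space sv \<and>
     (\<forall>x\<in>L. Vector_Spaces.linear sv sv (\<rho> x)) \<and>
     (\<forall>x\<in>L. \<forall>y\<in>L. \<rho> (x + y) = \<rho> x + \<rho> y) \<and>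
     (\<forall>z. \<forall>x\<in>L. \<rho> (sl z x) = op_scale sv z (\<rho> x)) \<and>
     (\<forall>x\<in>L. \<forall>y\<in>L. \<rho> (br x y) = commutator (\<rho> x) (\<rho> y))"

text \<open>
  \<open>'l list \<Rightarrow>\<^sub>0 complex\<close>, restricted to words in \<open>L\<close>, is the free associative algebra on the set \<open>L\<close>.
  The first three families below span the two-sided ideal whose quotient is \<open>U(L)\<close>.  The last one
  spans, modulo that ideal, the left ideal generated by all \<open>p - \<chi>(p)\<close> with \<open>p \<in> P\<close>.  The quotient
  by the sum is \<open>U(L) \<otimes>\<^bsub>U(P)\<^esub> \<complex>\<^sub>\<chi>\<close>, the empty word representing \<open>1 \<otimes> 1\<close>.
\<close>

definition induced_relations ::
  "(complex \<Rightarrow> 'l::ab_group_add \<Rightarrow> 'l) \<Rightarrow> ('l \<Rightarrow> 'l \<Rightarrow> 'l) \<Rightarrow> 'l set \<Rightarrow> 'l set \<Rightarrow> ('l \<Rightarrow> complex) \<Rightarrow>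
     ('l list \<Rightarrow>\<^sub>0 complex) set" where
  "induced_relations sl br L P \<chi> =
     {Poly_Mapping.single (u @ [x + y] @ w) 1 - Poly_Mapping.single (u @ [x] @ w) 1
        - Poly_Mapping.single (u @ [y] @ w) 1 | u w x y.
        u \<in> lists L \<and> w \<in> lists L \<and> x \<in> L \<and> y \<in> L} \<union>
     {Poly_Mapping.single (u @ [sl z x] @ w) 1 - Poly_Mapping.single (u @ [x] @ w) z | u w x z.
        u \<in> lists L \<and> w \<in> lists L \<and> x \<in> L} \<union>
     {Poly_Mapping.single (u @ [x, y] @ w) 1 - Poly_Mapping.single (u @ [y, x] @ w) 1
        - Poly_Mapping.single (u @ [br x y] @ w) 1 | u w x y.
        u \<in> lists L \<and> w \<in> lists L \<and> x \<in> L \<and> y \<in> L} \<union>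
     {Poly_Mapping.single (u @ [p]) 1 - Poly_Mapping.single u (\<chi> p) | u p.
        u \<in> lists L \<and> p \<in> P}"

definition word_action ::
  "(complex \<Rightarrow> 'v::ab_group_add \<Rightarrow> 'v) \<Rightarrow> ('l \<Rightarrow> 'v \<Rightarrow> 'v) \<Rightarrow> ('l list \<Rightarrow>\<^sub>0 complex) \<Rightarrow> 'v \<Rightarrow> 'v" where
  "word_action sv \<rho> q v =
     (\<Sum>w\<in>Poly_Mapping.keys q. sv (Poly_Mapping.lookup q w) (foldr \<rho> w v))"

text \<open>
  The \<open>L\<close>-module \<open>'v\<close> is the module induced from the character \<open>\<chi>\<close> of \<open>P\<close>: the map
  \<open>q \<mapsto> q \<cdot> v0\<close> identifies it with the quotient described above.
\<close>

definition induced_module ::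
  "(complex \<Rightarrow> 'l::ab_group_add \<Rightarrow> 'l) \<Rightarrow> ('l \<Rightarrow> 'l \<Rightarrow> 'l) \<Rightarrow> 'l set \<Rightarrow> 'l set \<Rightarrow> ('l \<Rightarrow> complex) \<Rightarrow>
     (complex \<Rightarrow> 'v::ab_group_add \<Rightarrow> 'v) \<Rightarrow> ('l \<Rightarrow> 'v \<Rightarrow> 'v) \<Rightarrow> 'v \<Rightarrow> bool" where
  "induced_module sl br L P \<chi> sv \<rho> v0 \<longleftrightarrow>
     lie_module sl br L sv \<rho> \<and>
     (\<forall>v. \<exists>q. Poly_Mapping.keys q \<subseteq> lists L \<and> word_action sv \<rho> q v0 = v) \<and>
     (\<forall>q. Poly_Mapping.keys q \<subseteq> lists L \<longrightarrow>
        (word_action sv \<rho> q v0 = 0 \<longleftrightarrow>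
         q \<in> module.span (\<lambda>z. Poly_Mapping.map ((*) z)) (induced_relations sl br L P \<chi>)))"

text \<open>The \<open>\<gg>~\<close>-module \<open>N(k\<Lambda>\<^sub>0)\<close>.\<close>

definition is_vacuum_module ::
  "(complex \<Rightarrow> 'g::ab_group_add \<Rightarrow> 'g) \<Rightarrow> ('g \<Rightarrow> 'g \<Rightarrow> 'g) \<Rightarrow> ('g \<Rightarrow> 'g \<Rightarrow> complex) \<Rightarrow> complex \<Rightarrow>
     (complex \<Rightarrow> 'v::ab_group_add \<Rightarrow> 'v) \<Rightarrow> ('g affine \<Rightarrow> 'v \<Rightarrow> 'v) \<Rightarrow> 'v \<Rightarrow> bool" where
  "is_vacuum_module s br form k sv \<rho> vac \<longleftrightarrow>
     induced_module (aff_scale s) (aff_bracket s br form) (twisted_affine s id 1) affine_ge0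
       (\<lambda>(f, \<alpha>, \<beta>). k * \<alpha>) sv \<rho> vac"

definition restricted_module ::
  "(complex \<Rightarrow> 'g::ab_group_add \<Rightarrow> 'g) \<Rightarrow> ('g \<Rightarrow> 'g \<Rightarrow> 'g) \<Rightarrow> ('g \<Rightarrow> 'g \<Rightarrow> complex) \<Rightarrow> ('g \<Rightarrow> 'g) \<Rightarrow> nat \<Rightarrow>
     complex \<Rightarrow> (complex \<Rightarrow> 'm::ab_group_add \<Rightarrow> 'm) \<Rightarrow> ('g affine \<Rightarrow> 'm \<Rightarrow> 'm) \<Rightarrow> bool" where
  "restricted_module s br form \<sigma> T k sm \<rho> \<longleftrightarrow>
     lie_module (aff_scale s) (aff_bracket s br form) (twisted_affine s \<sigma> T) sm \<rho> \<and>
     (\<forall>v. \<rho> aff_c v = sm k v) \<and>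
     (\<forall>v. \<forall>j\<in>{0..<int T}. \<exists>N. \<forall>n\<ge>N. \<forall>a\<in>graded_part s \<sigma> T j.
        \<rho> (mode a (of_int n + of_int j / of_nat T)) v = 0)"


section \<open>Vertex operator algebras and twisted modules\<close>

text \<open>
  \<open>Y a n\<close> is the coefficient of \<open>z\<^bsup>-n-1\<^esup>\<close> in \<open>Y(a, z)\<close>.  The Jacobi identity is stated for the
  coefficients of \<open>z\<^sub>0\<^bsup>-l-1\<^esup> z\<^sub>1\<^bsup>-m-1\<^esup> z\<^sub>2\<^bsup>-n-1\<^esup>\<close> of its two sides, applied to a vector.  By truncation
  the sums \<^const>\<open>Sum_any\<close> over \<open>i\<close> have finite support.
\<close>

definition truncated :: "('v \<Rightarrow> 'i::linorder \<Rightarrow> 'm \<Rightarrow> 'm::zero) \<Rightarrow> bool" where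
  "truncated Y \<longleftrightarrow> (\<forall>a w. \<exists>N. \<forall>n\<ge>N. Y a n w = 0)"

definition jacobi :: "(complex \<Rightarrow> 'v::ab_group_add \<Rightarrow> 'v) \<Rightarrow> ('v \<Rightarrow> int \<Rightarrow> 'v \<Rightarrow> 'v) \<Rightarrow> bool" where
  "jacobi sv Y \<longleftrightarrow> (\<forall>a b v. \<forall>l m n.
     Sum_any (\<lambda>i::nat. sv ((-1) ^ i * (of_int l gchoose i))
        (Y a (m + l - int i) (Y b (n + int i) v)
         - sv ((-1) powi l) (Y b (n + l - int i) (Y a (m + int i) v))))
     = Sum_any (\<lambda>i::nat. sv (of_int m gchoose i) (Y (Y a (l + int i) b) (m + n - int i) v)))"

definition vir :: "('v \<Rightarrow> int \<Rightarrow> 'v \<Rightarrow> 'v) \<Rightarrow> 'v \<Rightarrow> int \<Rightarrow> 'v \<Rightarrow> 'v" where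
  "vir Y \<omega> n = Y \<omega> (n + 1)"

definition voa ::
  "(complex \<Rightarrow> 'v::ab_group_add \<Rightarrow> 'v) \<Rightarrow> ('v \<Rightarrow> int \<Rightarrow> 'v \<Rightarrow> 'v) \<Rightarrow> 'v \<Rightarrow> 'v \<Rightarrow> bool" where
  "voa sv Y vac \<omega> \<longleftrightarrow>
     vector_space sv \<and>
     (\<forall>n v. Vector_Spaces.linear sv sv (\<lambda>a. Y a n v)) \<and>
     (\<forall>a n. Vector_Spaces.linear sv sv (Y a n)) \<and>
     truncated Y \<and>
     (\<forall>n. Y vac n = (if n = -1 then id else 0)) \<and>
     (\<forall>a. Y a (-1) vac = a \<and> (\<forall>n\<ge>0. Y a n vac = 0)) \<and>
     jacobi sv Y \<and>
     (\<exists>cc. \<forall>m n v. commutator (vir Y \<omega> m) (vir Y \<omega> n) v =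
        sv (of_int (m - n)) (vir Y \<omega> (m + n) v)
        + sv (if m + n = 0 then of_int (m ^ 3 - m) / 12 * cc else 0) v) \<and>
     (\<forall>a n v. Y (vir Y \<omega> (-1) a) n v = sv (- of_int n) (Y a (n - 1) v)) \<and>
     module.span sv (\<Union>n::int. eigenspace sv (vir Y \<omega> 0) (of_int n)) = UNIV \<and>
     (\<forall>n::int. finite_dim sv (eigenspace sv (vir Y \<omega> 0) (of_int n))) \<and>
     (\<exists>N. \<forall>n<N. eigenspace sv (vir Y \<omega> 0) (of_int n) = {0})"

definition voa_automorphism ::
  "(complex \<Rightarrow> 'v::ab_group_add \<Rightarrow> 'v) \<Rightarrow> ('v \<Rightarrow> int \<Rightarrow> 'v \<Rightarrow> 'v) \<Rightarrow> 'v \<Rightarrow> 'v \<Rightarrow> ('v \<Rightarrow> 'v) \<Rightarrow> bool" where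
  "voa_automorphism sv Y vac \<omega> \<tau> \<longleftrightarrow>
     Vector_Spaces.linear sv sv \<tau> \<and> bij \<tau> \<and> \<tau> vac = vac \<and> \<tau> \<omega> = \<omega> \<and>
     (\<forall>a n b. \<tau> (Y a n b) = Y (\<tau> a) n (\<tau> b))"

text \<open>
  \<open>Y\<^sub>M v n\<close> is the coefficient of \<open>z\<^bsup>-n-1\<^esup>\<close> in \<open>Y\<^sub>M(v, z)\<close>, for rational \<open>n\<close>.  In the twisted
  identity the coefficients of \<open>z\<^sub>1\<^bsup>-m-1\<^esup>\<close> with \<open>m \<notin> j/T + \<int>\<close> vanish on both sides.
\<close>

definition twisted_jacobi ::
  "(complex \<Rightarrow> 'v::ab_group_add \<Rightarrow> 'v) \<Rightarrow> ('v \<Rightarrow> int \<Rightarrow> 'v \<Rightarrow> 'v) \<Rightarrow> ('v \<Rightarrow> 'v) \<Rightarrow> nat \<Rightarrow>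
     (complex \<Rightarrow> 'm::ab_group_add \<Rightarrow> 'm) \<Rightarrow> ('v \<Rightarrow> rat \<Rightarrow> 'm \<Rightarrow> 'm) \<Rightarrow> bool" where
  "twisted_jacobi sv Y \<tau> T sm YM \<longleftrightarrow>
     (\<forall>j\<in>{0..<int T}. \<forall>a\<in>graded_part sv \<tau> T j. \<forall>b w. \<forall>l::int. \<forall>m. \<forall>n\<in>frac_ints T.
        m - of_int j / of_nat T \<in> \<int> \<longrightarrow>
        Sum_any (\<lambda>i::nat. sm ((-1) ^ i * (of_int l gchoose i))
           (YM a (m + of_int l - of_nat i) (YM b (n + of_nat i) w)
            - sm ((-1) powi l) (YM b (n + of_int l - of_nat i) (YM a (m + of_nat i) w))))
        = Sum_any (\<lambda>i::nat. sm (of_rat m gchoose i) (YM (Y a (l + int i) b) (m + n - of_nat i) w)))"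

definition weak_twisted_module ::
  "(complex \<Rightarrow> 'v::ab_group_add \<Rightarrow> 'v) \<Rightarrow> ('v \<Rightarrow> int \<Rightarrow> 'v \<Rightarrow> 'v) \<Rightarrow> 'v \<Rightarrow> 'v \<Rightarrow> ('v \<Rightarrow> 'v) \<Rightarrow> nat \<Rightarrow>
     (complex \<Rightarrow> 'm::ab_group_add \<Rightarrow> 'm) \<Rightarrow> ('v \<Rightarrow> rat \<Rightarrow> 'm \<Rightarrow> 'm) \<Rightarrow> bool" where
  "weak_twisted_module sv Y vac \<omega> \<tau> T sm YM \<longleftrightarrow>
     voa sv Y vac \<omega> \<and> voa_automorphism sv Y vac \<omega> \<tau> \<and> has_order \<tau> T \<and>
     vector_space sm \<and>
     (\<forall>n w. Vector_Spaces.linear sv sm (\<lambda>a. YM a n w)) \<and>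
     (\<forall>a n. Vector_Spaces.linear sm sm (YM a n)) \<and>
     (\<forall>a n. n \<notin> frac_ints T \<longrightarrow> YM a n = 0) \<and>
     truncated YM \<and>
     (\<forall>n. YM vac n = (if n = -1 then id else 0)) \<and>
     (\<forall>j\<in>{0..<int T}. \<forall>a\<in>graded_part sv \<tau> T j. \<forall>n.
        n - of_int j / of_nat T \<notin> \<int> \<longrightarrow> YM a n = 0) \<and>
     twisted_jacobi sv Y \<tau> T sm YM"

definition faithful :: "('v::zero \<Rightarrow> rat \<Rightarrow> 'm \<Rightarrow> 'm::zero) \<Rightarrow> bool" where
  "faithful YM \<longleftrightarrow> (\<forall>v. (\<forall>n. YM v n = 0) \<longrightarrow> v = 0)"

definition sugawara ::
  "complex \<Rightarrow> complex \<Rightarrow> 'g::zero set \<Rightarrow> (complex \<Rightarrow> 'v::ab_group_add \<Rightarrow> 'v) \<Rightarrow>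
     ('g affine \<Rightarrow> 'v \<Rightarrow> 'v) \<Rightarrow> 'v \<Rightarrow> 'v" where
  "sugawara k hv B sv \<rho> vac =
     sv (1 / (2 * (k + hv))) (\<Sum>a\<in>B. \<rho> (mode a (-1)) (\<rho> (mode a (-1)) vac))"

text \<open>These two conditions determine \<open>Y\<close> and \<open>\<tau>\<close>, since \<open>N(k\<Lambda>\<^sub>0)\<close> is generated by the \<open>a(-1)\<one>\<close>.\<close>

definition extends_currents ::
  "('g::zero affine \<Rightarrow> 'v \<Rightarrow> 'v) \<Rightarrow> 'v \<Rightarrow> ('v \<Rightarrow> int \<Rightarrow> 'v \<Rightarrow> 'v) \<Rightarrow> bool" where
  "extends_currents \<rho> vac Y \<longleftrightarrow> (\<forall>a n. Y (\<rho> (mode a (-1)) vac) n = \<rho> (mode a (of_int n)))"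

definition induced_automorphism ::
  "('g::zero \<Rightarrow> 'g) \<Rightarrow> (complex \<Rightarrow> 'v::ab_group_add \<Rightarrow> 'v) \<Rightarrow> ('g affine \<Rightarrow> 'v \<Rightarrow> 'v) \<Rightarrow> 'v \<Rightarrow>
     ('v \<Rightarrow> 'v) \<Rightarrow> bool" where
  "induced_automorphism \<sigma> sv \<rho> vac \<tau> \<longleftrightarrow>
     Vector_Spaces.linear sv sv \<tau> \<and> \<tau> vac = vac \<and>
     (\<forall>a v. \<forall>n::int. \<tau> (\<rho> (mode a (of_int n)) v) = \<rho> (mode (\<sigma> a) (of_int n)) (\<tau> v))"

definition extends_twisted_currents ::
  "(complex \<Rightarrow> 'g::ab_group_add \<Rightarrow> 'g) \<Rightarrow> ('g \<Rightarrow> 'g) \<Rightarrow> nat \<Rightarrow> ('g affine \<Rightarrow> 'v \<Rightarrow> 'v) \<Rightarrow> 'v \<Rightarrow>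
     ('g affine \<Rightarrow> 'm \<Rightarrow> 'm) \<Rightarrow> ('v \<Rightarrow> rat \<Rightarrow> 'm \<Rightarrow> 'm) \<Rightarrow> bool" where
  "extends_twisted_currents s \<sigma> T \<rho>V vac \<rho>M YM \<longleftrightarrow>
     (\<forall>m\<in>frac_ints T. \<forall>a\<in>graded_part s \<sigma> T (residue T m).
        YM (\<rho>V (mode a (-1)) vac) m = \<rho>M (mode a m))"


section \<open>Loop modules of operators\<close>

definition g_ops :: "('g::zero affine \<Rightarrow> 'v \<Rightarrow> 'v) \<Rightarrow> ('v \<Rightarrow> 'v) set" where
  "g_ops \<rho> = {\<rho> (mode x 0) | x. True}"

definition killed_by_positive :: "('g::zero affine \<Rightarrow> 'v \<Rightarrow> 'v::zero) \<Rightarrow> 'v set \<Rightarrow> bool" where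
  "killed_by_positive \<rho> R \<longleftrightarrow> (\<forall>n::int. n > 0 \<longrightarrow> (\<forall>x. \<forall>r\<in>R. \<rho> (mode x (of_int n)) r = 0))"

definition coeff_space ::
  "(complex \<Rightarrow> 'm::ab_group_add \<Rightarrow> 'm) \<Rightarrow> ('v \<Rightarrow> rat \<Rightarrow> 'm \<Rightarrow> 'm) \<Rightarrow> nat \<Rightarrow> 'v set \<Rightarrow> ('m \<Rightarrow> 'm) set" where
  "coeff_space sm YM T R = module.span (op_scale sm) {YM r n | r n. r \<in> R \<and> n \<in> frac_ints T}"

definition loop_formula ::
  "(complex \<Rightarrow> 'g::ab_group_add \<Rightarrow> 'g) \<Rightarrow> ('g \<Rightarrow> 'g) \<Rightarrow> nat \<Rightarrow> ('g affine \<Rightarrow> 'v \<Rightarrow> 'v) \<Rightarrow>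
     ('g affine \<Rightarrow> 'm::ab_group_add \<Rightarrow> 'm) \<Rightarrow> ('v \<Rightarrow> rat \<Rightarrow> 'm \<Rightarrow> 'm) \<Rightarrow> 'v set \<Rightarrow> bool" where
  "loop_formula s \<sigma> T \<rho>V \<rho>M YM R \<longleftrightarrow>
     (\<forall>m\<in>frac_ints T. \<forall>n\<in>frac_ints T. \<forall>x\<in>graded_part s \<sigma> T (residue T m). \<forall>r\<in>R.
        commutator (\<rho>M (mode x m)) (YM r n) = YM (\<rho>V (mode x 0) r) (m + n))"

text \<open>
  The adjoint action on operators of \<open>M\<close>, with \<open>d\<close> represented by \<open>-L(0)\<close>, where
  \<open>L(0) = Res\<^sub>z z Y\<^sub>M(\<omega>, z)\<close>.
\<close>

definition adjoint_ops ::
  "(complex \<Rightarrow> 'g::ab_group_add \<Rightarrow> 'g) \<Rightarrow> ('g \<Rightarrow> 'g) \<Rightarrow> nat \<Rightarrow> (complex \<Rightarrow> 'm::ab_group_add \<Rightarrow> 'm) \<Rightarrow>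
     ('g affine \<Rightarrow> 'm \<Rightarrow> 'm) \<Rightarrow> ('v \<Rightarrow> rat \<Rightarrow> 'm \<Rightarrow> 'm) \<Rightarrow> 'v \<Rightarrow> (('m \<Rightarrow> 'm) \<Rightarrow> 'm \<Rightarrow> 'm) set" where
  "adjoint_ops s \<sigma> T sm \<rho>M YM \<omega> =
     {commutator (\<rho>M (f, \<alpha>, 0) - op_scale sm \<beta> (YM \<omega> 1)) | f \<alpha> \<beta>.
        (f, \<alpha>, \<beta>) \<in> twisted_affine s \<sigma> T}"

definition loop_module ::
  "(complex \<Rightarrow> 'g::ab_group_add \<Rightarrow> 'g) \<Rightarrow> ('g \<Rightarrow> 'g) \<Rightarrow> nat \<Rightarrow> ('g affine \<Rightarrow> 'v \<Rightarrow> 'v) \<Rightarrow>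
     (complex \<Rightarrow> 'm::ab_group_add \<Rightarrow> 'm) \<Rightarrow> ('g affine \<Rightarrow> 'm \<Rightarrow> 'm) \<Rightarrow> ('v \<Rightarrow> rat \<Rightarrow> 'm \<Rightarrow> 'm) \<Rightarrow> 'v \<Rightarrow>
     'v set \<Rightarrow> bool" where
  "loop_module s \<sigma> T \<rho>V sm \<rho>M YM \<omega> R \<longleftrightarrow>
     stable_under (adjoint_ops s \<sigma> T sm \<rho>M YM \<omega>) (coeff_space sm YM T R) \<and>
     loop_formula s \<sigma> T \<rho>V \<rho>M YM R"

text \<open>
  The one-dimensional trivial module is not counted as an irreducible loop module: for
  \<open>R = \<complex>\<one>\<close> the coefficient space is \<open>\<complex> id\<^sub>M\<close>, with trivial action.
\<close>

definition irreducible_loop_module ::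
  "(complex \<Rightarrow> 'g::ab_group_add \<Rightarrow> 'g) \<Rightarrow> ('g \<Rightarrow> 'g) \<Rightarrow> nat \<Rightarrow> ('g affine \<Rightarrow> 'v \<Rightarrow> 'v) \<Rightarrow>
     (complex \<Rightarrow> 'm::ab_group_add \<Rightarrow> 'm) \<Rightarrow> ('g affine \<Rightarrow> 'm \<Rightarrow> 'm) \<Rightarrow> ('v \<Rightarrow> rat \<Rightarrow> 'm \<Rightarrow> 'm) \<Rightarrow> 'v \<Rightarrow>
     'v set \<Rightarrow> bool" where
  "irreducible_loop_module s \<sigma> T \<rho>V sm \<rho>M YM \<omega> R \<longleftrightarrow>
     loop_module s \<sigma> T \<rho>V sm \<rho>M YM \<omega> R \<and>
     nontrivial_irreducible_under (op_scale sm) (adjoint_ops s \<sigma> T sm \<rho>M YM \<omega>) (coeff_space sm YM T R)"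

end

theory Submission
  imports Defs
begin

text \<open>
  The commutator form of the twisted Jacobi identity gives
  \<open>[x(m), r\<^sub>n] = \<Sum>\<^sub>i (m choose i) (x(i)r)\<^bsub>m+n-i\<^esub>\<close>; the terms with \<open>i > 0\<close> vanish if \<open>\<gg>(n)R = 0\<close> for
  \<open>n > 0\<close>, and conversely, for fixed \<open>m + n\<close>, they are the coefficients of a polynomial in \<open>m\<close>.

  The Casimir tensor is invariant, so \<open>x(0)\<omega> = 0\<close> and \<open>L(0)\<close> commutes with \<open>\<gg>\<close> on \<open>N(k\<Lambda>\<^sub>0)\<close>.  When
  \<open>L(0)\<close> is a scalar \<open>h\<close> on \<open>R\<close>, the coefficient \<open>r\<^sub>n\<close> is an eigenvector of \<open>ad L(0)\<close> for \<open>h - 1 - n\<close>, so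
  a nonzero submodule of the coefficient space contains some \<open>r\<^sub>n \<noteq> 0\<close> with \<open>r\<close> homogeneous for \<open>\<sigma>\<close>.
  Bracketing with all \<open>x(m)\<close> puts every coefficient of \<open>x(0)r\<close> into the submodule, and the vectors of
  \<open>R\<close> all of whose coefficients lie in it form a \<open>\<gg>\<close>-submodule of \<open>R\<close>.

  In the converse direction \<open>L(-1)\<close> is used as well: \<open>[L(-1), r\<^sub>n] = -n r\<^sub>n\<^sub>-\<^sub>1\<close> excludes both a trivial
  action of \<open>\<gg>\<close> on \<open>R\<close> and two different \<open>L(0)\<close>-weights in \<open>R\<close> that yield the same operators up to a
  shift of \<open>n\<close>.
\<close>

section \<open>Eigenspaces and operators\<close>

text \<open>Applying \<open>A - c a\<close> removes the component \<open>w a\<close> and multiplies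
  every other \<open>w n\<close> by \<open>c n - c a \<noteq> 0\<close>, which drives an induction
  on \<open>F\<close>; \<open>w a\<close> is then recovered as a difference.\<close>

lemma (in vector_space) eigen_components_mem:
  assumes U: "subspace U" and A: "Vector_Spaces.linear scale scale A" and AU: "A ` U \<subseteq> U"
    and "finite F" and eig: "\<And>n. n \<in> F \<Longrightarrow> A (w n) = scale (c n) (w n)"
    and inj: "inj_on c F" and mem: "(\<Sum>n\<in>F. w n) \<in> U"
  shows "\<forall>n\<in>F. w n \<in> U"
  using \<open>finite F\<close> eig inj mem
proof (induction F arbitrary: w rule: finite_induct)
  case empty
  then show ?case by simp
next
  case (insert a F)
  interpret A: Vector_Spaces.linear scale scale A by (fact A)
  let ?u = "\<Sum>n\<in>insert a F. w n"
  let ?w' = "\<lambda>n. scale (c n - c a) (w n)"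
  have "A ?u - scale (c a) ?u \<in> U"
    using insert.prems(3) AU U by (blast intro: subspace_diff subspace_scale)
  moreover have "A ?u - scale (c a) ?u = (\<Sum>n\<in>F. ?w' n)"
    using insert.hyps insert.prems(1)
    by (simp add: A.sum A.add scale_right_distrib scale_sum_right scale_left_diff_distrib sum_subtractf)
  ultimately have "(\<Sum>n\<in>F. ?w' n) \<in> U" by simp
  moreover have "A (?w' n) = scale (c n) (?w' n)" if "n \<in> F" for n
    using insert.prems(1)[of n] that by (simp add: A.scale mult.commute)
  ultimately have *: "\<forall>n\<in>F. ?w' n \<in> U"
    using insert.IH[of ?w'] insert.prems(2) by (auto simp: inj_on_def)
  have F: "w n \<in> U" if "n \<in> F" for n
  proof -
    have "c n - c a \<noteq> 0"
      using insert.prems(2) insert.hyps that by (auto simp: inj_on_def)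
    then have "w n = scale (1 / (c n - c a)) (?w' n)" by simp
    then show ?thesis using * that U subspace_scale by metis
  qed
  have "w a = ?u - (\<Sum>n\<in>F. w n)" using insert.hyps by simp
  then have "w a \<in> U"
    using insert.prems(3) U F by (metis subspace_diff subspace_sum)
  then show ?case using F by simp
qed

text \<open>If \<open>d = c a\<close>, replacing \<open>w a\<close> by \<open>w a - u\<close> gives
  eigenvectors with sum 0, and \<open>eigen_components_mem\<close> for the zero subspace makes each
  of them 0. Otherwise \<open>- u\<close> joins the family as one more eigenvector.\<close>

lemma (in vector_space) eigenvector_in_eigen_sum:
  assumes A: "Vector_Spaces.linear scale scale A"
    and F: "finite F" and eig: "\<And>n. n \<in> F \<Longrightarrow> A (w n) = scale (c n) (w n)"
    and inj: "inj_on c F" and u: "u = (\<Sum>n\<in>F. w n)" "A u = scale d u"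
  shows "u = 0 \<or> (\<exists>n\<in>F. c n = d \<and> u = w n)"
proof (cases "\<exists>n\<in>F. c n = d")
  case True
  then obtain a where a: "a \<in> F" "c a = d" by blast
  interpret A: Vector_Spaces.linear scale scale A by (fact A)
  have "(\<Sum>n\<in>F. if n = a then w a - u else w n) = (\<Sum>n\<in>F - {a}. w n) + (w a - u)"
    using F a by (simp add: sum.remove)
  also have "\<dots> = 0"
    using F a u by (simp add: sum.remove)
  finally have "\<forall>n\<in>F. (if n = a then w a - u else w n) \<in> {0}"
    using F inj a eig u(2)
    by (intro eigen_components_mem[OF subspace_single_0 A])
       (auto simp: A.zero A.diff scale_right_diff_distrib)
  then show ?thesis using a by (auto dest!: bspec[of _ _ a])
next
  case False
  interpret A: Vector_Spaces.linear scale scale A by (fact A)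
  \<comment> \<open>\<open>None\<close> indexes the extra eigenvector \<open>- u\<close> with
    eigenvalue \<open>d\<close>.\<close>
  define c' where "c' = (\<lambda>x. case x of None \<Rightarrow> d | Some n \<Rightarrow> c n)"
  define w' where "w' = (\<lambda>x. case x of None \<Rightarrow> - u | Some n \<Rightarrow> w n)"
  have "(\<Sum>x\<in>insert None (Some ` F). w' x) = 0"
    using F u(1) by (simp add: w'_def sum.reindex)
  then have "\<forall>x\<in>insert None (Some ` F). w' x \<in> {0}"
    using F eig inj u(2) False
    by (intro eigen_components_mem[OF subspace_single_0 A, where c = c'])
       (auto simp: A.zero A.neg w'_def c'_def inj_on_def split: option.splits)
  then show ?thesis by (simp add: w'_def)
qed

lemma (in vector_space) span_UN_subspaces:
  assumes E: "\<And>i. i \<in> I \<Longrightarrow> subspace (E i)" and v: "v \<in> span (\<Union>i\<in>I. E i)"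
  shows "\<exists>F w. finite F \<and> F \<subseteq> I \<and> (\<forall>i\<in>F. w i \<in> E i) \<and> v = (\<Sum>i\<in>F. w i)"
proof -
  \<comment> \<open>Families are padded by zero outside \<open>F\<close>, so that two decompositions
    add over the union of their index sets.\<close>
  define P where "P F w u \<longleftrightarrow> finite F \<and> F \<subseteq> I \<and> (\<forall>i\<in>I. w i \<in> E i) \<and> (\<forall>i. i \<notin> F \<longrightarrow> w i = 0)
    \<and> u = (\<Sum>i\<in>F. w i)" for F w u
  have "subspace {u. \<exists>F w. P F w u}"
  proof (rule subspaceI; (elim CollectE exE)?)
    have "P {} (\<lambda>i. 0) 0" using E subspace_0 by (simp add: P_def)
    then show "0 \<in> {u. \<exists>F w. P F w u}" by (intro CollectI exI)
  next
    fix u u' F w F' w' assume F: "P F w u" and F': "P F' w' u'"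
    have "(\<Sum>i\<in>F. w i) = (\<Sum>i\<in>F \<union> F'. w i)" "(\<Sum>i\<in>F'. w' i) = (\<Sum>i\<in>F \<union> F'. w' i)"
      using F F' by (auto simp: P_def intro!: sum.mono_neutral_left)
    then have "u + u' = (\<Sum>i\<in>F \<union> F'. w i + w' i)"
      using F F' by (simp only: sum.distrib P_def)
    moreover have "\<forall>i\<in>I. w i + w' i \<in> E i"
      using F F' E by (auto simp: P_def intro!: subspace_add)
    ultimately have "P (F \<union> F') (\<lambda>i. w i + w' i) (u + u')"
      using F F' by (simp add: P_def)
    then show "u + u' \<in> {u. \<exists>F w. P F w u}" by (intro CollectI exI)
  next
    fix c u F w assume F: "P F w u"
    moreover have "\<forall>i\<in>I. scale c (w i) \<in> E i"
      using F E by (auto simp: P_def intro!: subspace_scale)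
    ultimately have "P F (\<lambda>i. scale c (w i)) (scale c u)"
      by (simp add: scale_sum_right P_def)
    then show "scale c u \<in> {u. \<exists>F w. P F w u}" by (intro CollectI exI)
  qed
  moreover have "(\<Union>i\<in>I. E i) \<subseteq> {u. \<exists>F w. P F w u}"
  proof
    fix x assume "x \<in> (\<Union>i\<in>I. E i)"
    then obtain i where i: "i \<in> I" "x \<in> E i" by blast
    then have "\<forall>j\<in>I. (if j = i then x else 0) \<in> E j"
      using E subspace_0 by auto
    then have "P {i} (\<lambda>j. if j = i then x else 0) x" using i(1) by (simp add: P_def)
    then show "x \<in> {u. \<exists>F w. P F w u}" by (intro CollectI exI)
  qed
  ultimately have "v \<in> {u. \<exists>F w. P F w u}"
    by (rule span_minimal[THEN subsetD, OF _ _ v, rotated])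
  then obtain F w where "P F w v" by (elim CollectE exE)
  then have "finite F" "F \<subseteq> I" "\<forall>i\<in>F. w i \<in> E i" "v = (\<Sum>i\<in>F. w i)"
    by (auto simp: P_def)
  then show ?thesis by (intro exI conjI)
qed

text \<open>A vector-valued form of the fact that a polynomial with infinitely many zeros is 0. By
  Pascal's rule a finite difference in \<open>k\<close> turns \<open>gchoose Suc i\<close> into
  \<open>gchoose i\<close>, so the coefficients from \<open>v 1\<close> on satisfy the same
  relations with \<open>N\<close> lowered by one.\<close>

lemma gbinomial_combination_eq_0:
  fixes s :: "complex \<Rightarrow> 'b::ab_group_add \<Rightarrow> 'b"
  assumes s: "vector_space s"
    and "\<And>k::nat. (\<Sum>i\<le>N. s ((a + of_nat k) gchoose i) (v i)) = 0"
  shows "\<forall>i\<le>N. v i = 0"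
  using assms(2)
proof (induction N arbitrary: v)
  case 0
  interpret vector_space s by (fact s)
  from "0.prems"[of 0] show ?case by simp
next
  case (Suc N)
  interpret vector_space s by (fact s)
  have "(\<Sum>i\<le>N. s ((a + of_nat k) gchoose i) (v (Suc i))) = 0" for k
  proof -
    have "s ((a + of_nat k) gchoose i) (v (Suc i))
      = s ((a + of_nat (Suc k)) gchoose Suc i) (v (Suc i)) - s ((a + of_nat k) gchoose Suc i) (v (Suc i))" for i
    proof -
      have "a + of_nat (Suc k) = (a + of_nat k) + 1" by simp
      then have "((a + of_nat (Suc k)) gchoose Suc i) - ((a + of_nat k) gchoose Suc i)
          = ((a + of_nat k) gchoose i)"
        by (simp only: gbinomial_Suc_Suc add_diff_cancel_right')
      then show ?thesis by (simp only: scale_left_diff_distrib[symmetric])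
    qed
    then have "(\<Sum>i\<le>N. s ((a + of_nat k) gchoose i) (v (Suc i)))
      = (\<Sum>i\<le>N. s ((a + of_nat (Suc k)) gchoose Suc i) (v (Suc i)))
        - (\<Sum>i\<le>N. s ((a + of_nat k) gchoose Suc i) (v (Suc i)))"
      by (simp only: sum_subtractf)
    also have "\<dots> = (\<Sum>i\<le>Suc N. s ((a + of_nat (Suc k)) gchoose i) (v i))
        - (\<Sum>i\<le>Suc N. s ((a + of_nat k) gchoose i) (v i))"
      by (simp only: sum.atMost_Suc_shift gbinomial_0 add_diff_cancel_left)
    finally show ?thesis unfolding Suc.prems by simp
  qed
  then have v: "\<forall>i\<le>N. v (Suc i) = 0" by (rule Suc.IH)
  have "(\<Sum>i\<le>Suc N. s ((a + of_nat 0) gchoose i) (v i)) = v 0 + (\<Sum>i\<le>N. 0)"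
    unfolding sum.atMost_Suc_shift using v by (intro arg_cong2[where f = "(+)"] sum.cong) auto
  with Suc.prems[of 0] have "v 0 = 0" by simp
  show ?case
  proof (intro allI impI)
    fix i assume "i \<le> Suc N"
    then show "v i = 0" using v \<open>v 0 = 0\<close> by (cases i) auto
  qed
qed

section \<open>Commutators as linear maps\<close>

lemma vector_space_op_scale: "vector_space s \<Longrightarrow> vector_space (op_scale s)"
  by (auto simp: vector_space_def op_scale_def fun_eq_iff)

lemma linear_op_diff:
  assumes f: "Vector_Spaces.linear s s' f" and g: "Vector_Spaces.linear s s' g"
  shows "Vector_Spaces.linear s s' (f - g)"
proof -
  interpret f: Vector_Spaces.linear s s' f by (fact f)
  interpret g: Vector_Spaces.linear s s' g by (fact g)
  show ?thesis
    by unfold_locales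
       (simp_all add: f.add g.add f.scale g.scale f.vs2.scale_right_diff_distrib)
qed

lemma linear_op_scale:
  assumes f: "Vector_Spaces.linear s s f"
  shows "Vector_Spaces.linear s s (op_scale s c f)"
proof -
  interpret f: Vector_Spaces.linear s s f by (fact f)
  show ?thesis
    by unfold_locales
       (simp_all add: op_scale_def f.add f.scale f.vs1.scale_right_distrib mult.commute)
qed

lemma linear_commutator:
  assumes "Vector_Spaces.linear s s X"
  shows "Vector_Spaces.linear (op_scale s) (op_scale s) (commutator X)"
proof -
  interpret X: Vector_Spaces.linear s s X by (fact assms)
  have vs: "vector_space s" by unfold_locales
  show ?thesis
    unfolding Vector_Spaces.linear_iff
    by (simp add: vector_space_op_scale[OF vs] commutator_def fun_eq_iff op_scale_def
        X.add X.scale X.vs1.scale_right_diff_distrib algebra_simps)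
qed

lemma commutator_add_left:
  assumes "Vector_Spaces.linear s s u"
  shows "commutator (X + Y) u = commutator X u + commutator Y u"
proof -
  interpret u: Vector_Spaces.linear s s u by (fact assms)
  show ?thesis by (simp add: commutator_def fun_eq_iff u.add)
qed

lemma commutator_op_scale_left:
  assumes "Vector_Spaces.linear s s u"
  shows "commutator (op_scale s c X) u = op_scale s c (commutator X u)"
proof -
  interpret u: Vector_Spaces.linear s s u by (fact assms)
  show ?thesis
    by (simp add: commutator_def op_scale_def fun_eq_iff u.scale u.vs1.scale_right_diff_distrib)
qed

lemma commutator_sum_left:
  assumes "Vector_Spaces.linear s s u"
  shows "commutator (\<Sum>i\<in>I. X i) u = (\<Sum>i\<in>I. commutator (X i) u)"
proof -
  interpret u: Vector_Spaces.linear s s u by (fact assms)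
  have "commutator 0 u = 0" by (simp add: commutator_def fun_eq_iff u.zero)
  then show ?thesis
    by (induction I rule: infinite_finite_induct) (simp_all add: commutator_add_left[OF assms])
qed

lemma commutator_diff_left:
  assumes "Vector_Spaces.linear s s u"
  shows "commutator (X - Y) u = commutator X u - commutator Y u"
proof -
  interpret u: Vector_Spaces.linear s s u by (fact assms)
  show ?thesis by (simp add: commutator_def fun_eq_iff u.diff)
qed

section \<open>Eigenspaces of an automorphism of finite order\<close>

definition unit_root :: "nat \<Rightarrow> int \<Rightarrow> complex" where
  "unit_root T j = exp (2 * of_real pi * \<i> * of_int j / of_nat T)"

lemma unit_root_0 [simp]: "unit_root T 0 = 1"
  by (simp add: unit_root_def)

lemma unit_root_add: "unit_root T (i + j) = unit_root T i * unit_root T j"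
  by (simp add: unit_root_def distrib_left add_divide_distrib exp_add)

lemma unit_root_power: "unit_root T j ^ n = unit_root T (j * int n)"
  by (induction n) (simp_all add: unit_root_add distrib_left mult.commute)

lemma unit_root_eq_1_iff:
  assumes "0 < T"
  shows "unit_root T j = 1 \<longleftrightarrow> int T dvd j"
proof -
  have "unit_root T j = cis (2 * pi * of_int j / of_nat T)"
    by (simp add: unit_root_def cis_conv_exp mult_ac)
  also have "\<dots> = 1 \<longleftrightarrow> (\<exists>k::int. 2 * pi * of_int j / of_nat T = 2 * pi * of_int k)"
    by (auto simp: complex_eq_iff cos_one_2pi_int dest: sin_zero_iff_int2[THEN iffD1])
  also have "\<dots> \<longleftrightarrow> (\<exists>k::int. real_of_int j = real_of_int (k * int T))"
    using assms by (simp add: field_simps)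
  finally show ?thesis
    unfolding of_int_eq_iff dvd_def by (simp add: mult.commute)
qed

lemma unit_root_mod:
  assumes "0 < T"
  shows "unit_root T (j mod int T) = unit_root T j"
proof -
  have "unit_root T j = unit_root T (j mod int T) * unit_root T (int T * (j div int T))"
    by (simp flip: unit_root_add)
  then show ?thesis using assms by (simp add: unit_root_eq_1_iff)
qed

lemma sum_unit_root:
  assumes "0 < T" and "0 \<le> t" and "t < int T"
  shows "(\<Sum>j<T. unit_root T (- (int j * t))) = (if t = 0 then of_nat T else 0)"
proof (cases "t = 0")
  case False
  have "unit_root T (- t) \<noteq> 1"
    using assms False zdvd_not_zless by (auto simp: unit_root_eq_1_iff)
  moreover have "unit_root T (- t) ^ T = 1"
    using assms by (simp add: unit_root_power unit_root_eq_1_iff)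
  moreover have "unit_root T (- (int j * t)) = unit_root T (- t) ^ j" for j
    by (simp add: unit_root_power mult.commute)
  ultimately show ?thesis using False by (simp add: geometric_sum)
qed simp

lemma mem_graded_part: "x \<in> graded_part s f T j \<longleftrightarrow> f x = s (unit_root T j) x"
  by (simp add: graded_part_def eigenspace_def unit_root_def)

lemma graded_part_mod: "0 < T \<Longrightarrow> graded_part s f T (j mod int T) = graded_part s f T j"
  by (simp add: set_eq_iff mem_graded_part unit_root_mod)

text \<open>The Fourier projector of the cyclic group generated by \<open>f\<close>, for
  \<open>f\<close> of order \<open>T\<close>.\<close>

definition graded_proj ::
  "(complex \<Rightarrow> 'a::ab_group_add \<Rightarrow> 'a) \<Rightarrow> ('a \<Rightarrow> 'a) \<Rightarrow> nat \<Rightarrow> nat \<Rightarrow> 'a \<Rightarrow> 'a" where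
  "graded_proj s f T j x =
     s (1 / of_nat T) (\<Sum>t<T. s (unit_root T (- (int j * int t))) ((f ^^ t) x))"

lemma graded_proj_mem:
  assumes f: "Vector_Spaces.linear s s f" and ord: "has_order f T"
  shows "graded_proj s f T j x \<in> graded_part s f T (int j)"
proof -
  interpret f: Vector_Spaces.linear s s f by (fact f)
  have T: "0 < T" "f ^^ T = id" using ord by (auto simp: has_order_def)
  \<comment> \<open>The extra \<open>int j\<close> in the exponent makes \<open>?g (Suc t)\<close>
    the image under \<open>f\<close> of the \<open>t\<close>-th summand; a sum over a full period is
    unchanged by the shift.\<close>
  let ?g = "\<lambda>t. s (unit_root T (int j - int j * int t)) ((f ^^ t) x)"
  have "(\<Sum>t<T. ?g (Suc t)) + ?g 0 = (\<Sum>t<T. ?g t) + ?g T"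
    using sum.lessThan_Suc_shift[of ?g T] sum.lessThan_Suc[of ?g T] by (simp add: add.commute)
  moreover have "?g T = ?g 0"
    using T unit_root_eq_1_iff[of T "- (int j * int T)"] unit_root_add[of T "int j" "- (int j * int T)"]
    by simp
  ultimately have shift: "(\<Sum>t<T. ?g (Suc t)) = (\<Sum>t<T. ?g t)" by simp
  have root: "unit_root T (int j - int j * int t) = unit_root T (int j) * unit_root T (- (int j * int t))" for t
    using unit_root_add[of T "int j" "- (int j * int t)"] by simp
  have "f (graded_proj s f T j x)
      = s (1 / of_nat T) (\<Sum>t<T. ?g (Suc t))"
    by (simp add: graded_proj_def f.scale f.sum algebra_simps)
  also have "\<dots> = s (unit_root T (int j)) (graded_proj s f T j x)"
    unfolding shift graded_proj_def f.vs1.scale_sum_right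
    by (simp add: root)
  finally show ?thesis by (simp add: mem_graded_part)
qed

text \<open>After interchanging the sums, orthogonality of the characters of Z/T leaves the term
  \<open>t = 0\<close>.\<close>

lemma sum_graded_proj:
  assumes f: "Vector_Spaces.linear s s f" and ord: "has_order f T"
  shows "(\<Sum>j<T. graded_proj s f T j x) = x"
proof -
  interpret f: Vector_Spaces.linear s s f by (fact f)
  have T: "0 < T" using ord by (auto simp: has_order_def)
  have "(\<Sum>j<T. graded_proj s f T j x)
      = s (1 / of_nat T) (\<Sum>t<T. s (\<Sum>j<T. unit_root T (- (int j * int t))) ((f ^^ t) x))"
    unfolding graded_proj_def f.vs1.scale_sum_right[symmetric] f.vs1.scale_sum_left
    by (subst sum.swap) simp
  also have "\<dots> = s (1 / of_nat T) (\<Sum>t<T. if t = 0 then s (of_nat T) x else 0)"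
    using T by (intro arg_cong[where f = "s _"] sum.cong) (auto simp: sum_unit_root)
  also have "\<dots> = x" using T by simp
  finally show ?thesis .
qed

lemma graded_proj_subspace:
  assumes s: "vector_space s" and W: "module.subspace s W" "f ` W \<subseteq> W" "x \<in> W"
  shows "graded_proj s f T j x \<in> W"
proof -
  interpret vector_space s by (fact s)
  have "(f ^^ t) x \<in> W" for t using W by (induction t) auto
  then show ?thesis
    unfolding graded_proj_def using W(1) by (intro subspace_scale subspace_sum)
qed

section \<open>Fractional exponents and modes\<close>

lemma frac_ints_eq: "0 < T \<Longrightarrow> frac_ints T = range (\<lambda>p. of_int p / of_nat T)"
  by (auto simp: frac_ints_def field_simps elim!: Ints_cases)

lemma of_int_div_mem_frac_ints [simp]: "0 < T \<Longrightarrow> of_int p / of_nat T \<in> frac_ints T"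
  by (simp add: frac_ints_eq)

lemma frac_ints_add: "m \<in> frac_ints T \<Longrightarrow> n \<in> frac_ints T \<Longrightarrow> m + n \<in> frac_ints T"
  by (simp add: frac_ints_def distrib_right)

lemma frac_ints_diff: "m \<in> frac_ints T \<Longrightarrow> n \<in> frac_ints T \<Longrightarrow> m - n \<in> frac_ints T"
  by (simp add: frac_ints_def left_diff_distrib)

lemma of_int_mem_frac_ints [simp]: "of_int n \<in> frac_ints T"
  by (simp add: frac_ints_def)

lemma frac_ints_numerals [simp]: "0 \<in> frac_ints T" "1 \<in> frac_ints T" "- 1 \<in> frac_ints T"
  using of_int_mem_frac_ints[of 0 T] of_int_mem_frac_ints[of 1 T] of_int_mem_frac_ints[of "-1" T]
  by simp_all

lemma residue_of_int_div [simp]: "0 < T \<Longrightarrow> residue T (of_int p / of_nat T) = p mod int T"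
  by (simp add: residue_def)

lemma frac_diff_in_Ints_iff:
  assumes "0 < T"
  shows "(of_int p / of_nat T - of_int q / of_nat T :: rat) \<in> \<int> \<longleftrightarrow> p mod int T = q mod int T"
proof -
  have "(of_int p / of_nat T - of_int q / of_nat T :: rat) \<in> \<int>
      \<longleftrightarrow> (\<exists>k. of_int (p - q) = (of_int (int T * k) :: rat))"
    using assms by (auto simp: Ints_def field_simps) 
  also have "\<dots> \<longleftrightarrow> int T dvd p - q"
    unfolding of_int_eq_iff dvd_def ..
  finally show ?thesis by (simp add: mod_eq_dvd_iff)
qed

lemma mode_add: "mode (x + y) m = mode x m + mode y m"
  by (simp add: mode_def single_add)

lemma aff_scale_mode: "s c 0 = 0 \<Longrightarrow> aff_scale s c (mode x m) = mode (s c x) m"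
  by (simp add: aff_scale_def mode_def)

text \<open>The central term has the exponent of the first mode as a factor, which is 0
  here.\<close>

lemma aff_bracket_zero_mode:
  assumes "lie_algebra s br" 
  shows "aff_bracket s br form (mode a 0) (mode b n) = mode (br a b) n"
proof -
  interpret vector_space s using assms by (simp add: lie_algebra_def)
  have "br a 0 = 0" "br 0 b = 0"
    using assms vector_space_pair_axioms module_hom.zero[of s s "br a"] module_hom.zero[of s s "\<lambda>x. br x b"]
    by (auto simp: lie_algebra_def module_hom_iff_linear)
  then show ?thesis
    by (auto simp: aff_bracket_def mode_def)
qed

lemma mode_mem_twisted_affine:
  "m \<in> frac_ints T \<Longrightarrow> x \<in> graded_part s \<sigma> T (residue T m) \<Longrightarrow> mode x m \<in> twisted_affine s \<sigma> T"
  by (simp add: mode_def twisted_affine_def)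

lemma mode_mem_untwisted_affine:
  assumes "vector_space s"
  shows "mode x (of_int n) \<in> twisted_affine s id 1"
proof -
  interpret vector_space s by (fact assms)
  have "unit_root 1 j = 1" for j by (simp add: unit_root_eq_1_iff)
  then show ?thesis
    by (intro mode_mem_twisted_affine) (simp_all add: mem_graded_part)
qed

section \<open>Consequences of the twisted Jacobi identity\<close>

lemma Sum_any_only_0: "(\<And>i::nat. i \<noteq> 0 \<Longrightarrow> f i = 0) \<Longrightarrow> Sum_any f = f 0"
  using Sum_any.expand_superset[of "{0}" f] by auto

lemma Sum_any_up_to: "(\<And>i::nat. N < i \<Longrightarrow> f i = 0) \<Longrightarrow> Sum_any f = (\<Sum>i\<le>N. f i)"
  by (rule Sum_any.expand_superset) (auto simp: not_less[symmetric])

text \<open>The setting of all later arguments. The level enters as an equation of operators, and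
  \<open>hv\<close> becomes the dual Coxeter number in the final theorem.\<close>

locale twisted_current_module =
  fixes sg :: "complex \<Rightarrow> 'g::ab_group_add \<Rightarrow> 'g"
    and br :: "'g \<Rightarrow> 'g \<Rightarrow> 'g"
    and form :: "'g \<Rightarrow> 'g \<Rightarrow> complex"
    and B :: "'g set"
    and \<sigma> :: "'g \<Rightarrow> 'g"
    and T :: nat
    and k hv :: complex
    and sV :: "complex \<Rightarrow> 'v::ab_group_add \<Rightarrow> 'v"
    and \<rho>V :: "'g affine \<Rightarrow> 'v \<Rightarrow> 'v"
    and Y :: "'v \<Rightarrow> int \<Rightarrow> 'v \<Rightarrow> 'v"
    and vac \<omega> :: 'v
    and \<sigma>V :: "'v \<Rightarrow> 'v"
    and sM :: "complex \<Rightarrow> 'm::ab_group_add \<Rightarrow> 'm"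
    and \<rho>M :: "'g affine \<Rightarrow> 'm \<Rightarrow> 'm"
    and YM :: "'v \<Rightarrow> rat \<Rightarrow> 'm \<Rightarrow> 'm"
  assumes lie: "lie_algebra sg br"
    and form: "invariant_form sg br form"
    and orthonormal: "orthonormal_basis sg form B"
    and automorphism: "lie_automorphism sg br \<sigma>" "has_order \<sigma> T"
    and V_module: "lie_module (aff_scale sg) (aff_bracket sg br form) (twisted_affine sg id 1) sV \<rho>V"
    and conformal_vector: "\<omega> = sugawara k hv B sV \<rho>V vac"
    and vertex_algebra: "voa sV Y vac \<omega>" "extends_currents \<rho>V vac Y"
    and induced: "induced_automorphism \<sigma> sV \<rho>V vac \<sigma>V"
    and M_module: "lie_module (aff_scale sg) (aff_bracket sg br form) (twisted_affine sg \<sigma> T) sM \<rho>M"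
    and level: "\<rho>M aff_c = sM k"
    and twisted_module: "weak_twisted_module sV Y vac \<omega> \<sigma>V T sM YM"
      "extends_twisted_currents sg \<sigma> T \<rho>V vac \<rho>M YM"
begin

lemma T_pos [simp]: "0 < T"
  using automorphism(2) by (simp add: has_order_def)

sublocale g: vector_space sg
  using lie by (simp add: lie_algebra_def)

sublocale V: vector_space sV
  using vertex_algebra(1) by (simp add: voa_def)

sublocale M: vector_space sM
  using twisted_module(1) by (simp add: weak_twisted_module_def)

sublocale op: vector_space "op_scale sM"
  by (rule vector_space_op_scale) unfold_locales

sublocale Y_left: Vector_Spaces.linear sV sV "\<lambda>a. Y a n v" for n v
  using vertex_algebra(1) by (simp add: voa_def)

sublocale Y: Vector_Spaces.linear sV sV "Y a n" for a n
  using vertex_algebra(1) by (simp add: voa_def)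

sublocale YM: Vector_Spaces.linear sM sM "YM a n" for a n
  using twisted_module(1) by (simp add: weak_twisted_module_def)

sublocale YM_left: Vector_Spaces.linear sV "op_scale sM" "\<lambda>a. YM a n" for n
proof -
  have "Vector_Spaces.linear sV sM (\<lambda>a. YM a n w)" for w
    using twisted_module(1) by (simp add: weak_twisted_module_def)
  then show "Vector_Spaces.linear sV (op_scale sM) (\<lambda>a. YM a n)"
    using op.vector_space_axioms
    by (simp add: Vector_Spaces.linear_iff fun_eq_iff op_scale_def)
qed

sublocale \<sigma>: Vector_Spaces.linear sg sg \<sigma>
  using automorphism(1) by (simp add: lie_automorphism_def)

sublocale \<sigma>V: Vector_Spaces.linear sV sV \<sigma>V
  using induced by (simp add: induced_automorphism_def)

lemma \<sigma>V_order: "has_order \<sigma>V T"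
  using twisted_module(1) by (simp add: weak_twisted_module_def)

lemma \<sigma>V_Y: "\<sigma>V (Y a n b) = Y (\<sigma>V a) n (\<sigma>V b)" and \<sigma>V_\<omega>: "\<sigma>V \<omega> = \<omega>"
  using twisted_module(1) by (simp_all add: weak_twisted_module_def voa_automorphism_def)

lemma mode_mem: "mode x (of_int n) \<in> twisted_affine sg id 1"
  by (rule mode_mem_untwisted_affine) unfold_locales

lemma mode_mem_0: "mode x 0 \<in> twisted_affine sg id 1"
  and mode_mem_m1: "mode x (- 1) \<in> twisted_affine sg id 1"
  using mode_mem[of x 0] mode_mem[of x "-1"] by simp_all

lemma linear_current:
  "X \<in> twisted_affine sg id 1 \<Longrightarrow> Vector_Spaces.linear sV sV (\<rho>V X)"
  using V_module by (simp add: lie_module_def)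

lemma linear_current_left:
  "Vector_Spaces.linear sg sV (\<lambda>x. \<rho>V (mode x (of_int n)) v)"
proof -
  have "\<rho>V (mode (x + y) (of_int n)) v = \<rho>V (mode x (of_int n)) v + \<rho>V (mode y (of_int n)) v" for x y
    using V_module mode_mem[of x n] mode_mem[of y n] by (simp add: lie_module_def mode_add)
  moreover have "\<rho>V (mode (sg c x) (of_int n)) v = sV c (\<rho>V (mode x (of_int n)) v)" for c x
  proof -
    have "\<rho>V (aff_scale sg c (mode x (of_int n))) = op_scale sV c (\<rho>V (mode x (of_int n)))"
      using V_module mode_mem[of x n] unfolding lie_module_def by blast
    then show ?thesis by (simp add: aff_scale_mode op_scale_def)
  qed
  ultimately show ?thesis
    unfolding Vector_Spaces.linear_iff
    using g.vector_space_axioms V.vector_space_axioms by simp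
qed

sublocale current0: Vector_Spaces.linear sV sV "\<rho>V (mode x 0)" for x
  by (rule linear_current[OF mode_mem_0])

sublocale current0_left: Vector_Spaces.linear sg sV "\<lambda>x. \<rho>V (mode x 0) v" for v
  using linear_current_left[of 0 v] by simp

lemma current_Y: "Y (\<rho>V (mode x (- 1)) vac) n = \<rho>V (mode x (of_int n))"
  using vertex_algebra(2) by (simp add: extends_currents_def)

lemma \<sigma>V_current: "\<sigma>V (\<rho>V (mode x (of_int n)) v) = \<rho>V (mode (\<sigma> x) (of_int n)) (\<sigma>V v)"
  using induced by (simp add: induced_automorphism_def)

lemma vacuum_Y: "Y a (-1) vac = a" "0 \<le> n \<Longrightarrow> Y a n vac = 0"
  using vertex_algebra(1) by (simp_all add: voa_def)

lemma translation_Y: "Y (Y \<omega> 0 a) n v = sV (- of_int n) (Y a (n - 1) v)"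
  using vertex_algebra(1) by (simp add: voa_def vir_def)

lemma translation_eq: "Y \<omega> 0 a = Y a (-2) vac"
  using translation_Y[of a "-1" vac] by (simp add: vacuum_Y)

lemma current0_vac: "\<rho>V (mode x 0) vac = 0"
  using current_Y[of x 0] vacuum_Y(2)[of 0 "\<rho>V (mode x (- 1)) vac"] by simp

text \<open>The Jacobi identity at \<open>l = 0\<close>: on the left only \<open>i = 0\<close>
  survives, since \<open>0 gchoose i\<close> vanishes for \<open>i > 0\<close>.\<close>

lemma commutator_Y:
  "Y a m (Y b n v) - Y b n (Y a m v)
     = Sum_any (\<lambda>i. sV (of_int m gchoose i) (Y (Y a (int i) b) (m + n - int i) v))"
proof -
  have "jacobi sV Y" using vertex_algebra(1) by (simp add: voa_def)
  from this[unfolded jacobi_def, rule_format, where a = a and b = b and v = v and l = 0 and m = m and n = n]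
  show ?thesis
    by (subst (asm) Sum_any_only_0) (simp_all add: gbinomial_0_left)
qed

text \<open>Degree and exponent are given by the same integer \<open>p\<close> rather than by a
  residue. The eigenspace and the coset of exponents depend only on \<open>p\<close> modulo
  \<open>T\<close>, so \<open>p\<close> can be adapted to the exponent wanted.\<close>

lemma commutator_YM:
  assumes "a \<in> graded_part sV \<sigma>V T p" and m: "m = of_int p / of_nat T" and n: "n \<in> frac_ints T"
  shows "commutator (YM a m) (YM b n) w
     = Sum_any (\<lambda>i. sM (of_rat m gchoose i) (YM (Y a (int i) b) (m + n - of_nat i) w))"
proof -
  let ?j = "p mod int T"
  have tj: "twisted_jacobi sV Y \<sigma>V T sM YM"
    using twisted_module(1) by (simp add: weak_twisted_module_def)
  have "?j \<in> {0..<int T}" "a \<in> graded_part sV \<sigma>V T ?j" "m - of_int ?j / of_nat T \<in> \<int>"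
    using assms by (simp_all add: graded_part_mod frac_diff_in_Ints_iff)
  from tj[unfolded twisted_jacobi_def, rule_format, OF this(1,2) n this(3), where b = b and w = w and l = 0]
  show ?thesis
    by (subst (asm) Sum_any_only_0) (simp_all add: gbinomial_0_left commutator_def)
qed

lemma YM_not_frac: "n \<notin> frac_ints T \<Longrightarrow> YM a n = 0"
  using twisted_module(1) by (simp add: weak_twisted_module_def)

lemma YM_not_graded:
  assumes "a \<in> graded_part sV \<sigma>V T p" and "n = of_int q / of_nat T" and "p mod int T \<noteq> q mod int T"
  shows "YM a n = 0"
proof -
  have "\<forall>j\<in>{0..<int T}. \<forall>a\<in>graded_part sV \<sigma>V T j. \<forall>n. n - of_int j / of_nat T \<notin> \<int> \<longrightarrow> YM a n = 0"
    using twisted_module(1) by (simp add: weak_twisted_module_def)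
  from this[rule_format, of "p mod int T" a n] show ?thesis
    using assms by (simp add: graded_part_mod frac_diff_in_Ints_iff)
qed

lemma YM_vac: "n \<noteq> -1 \<Longrightarrow> YM vac n = 0"
  using twisted_module(1) by (simp add: weak_twisted_module_def)

text \<open>
  The twisted Jacobi identity for \<open>b = \<one>\<close> with \<open>l = -2\<close> and \<open>n = 0\<close>: its left-hand side vanishes, and
  on the right \<open>a\<^sub>-\<^sub>2\<one> = L(-1)a\<close> and \<open>a\<^sub>-\<^sub>1\<one> = a\<close> survive.
\<close>

lemma translation_YM_graded:
  assumes a: "a \<in> graded_part sV \<sigma>V T p" and m: "m = of_int p / of_nat T"
  shows "YM (Y \<omega> 0 a) m = op_scale sM (- of_rat m) (YM a (m - 1))"
proof
  fix w
  let ?j = "p mod int T"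
  have tj: "twisted_jacobi sV Y \<sigma>V T sM YM"
    using twisted_module(1) by (simp add: weak_twisted_module_def)
  have "?j \<in> {0..<int T}" "a \<in> graded_part sV \<sigma>V T ?j" "m - of_int ?j / of_nat T \<in> \<int>"
    using assms by (simp_all add: graded_part_mod frac_diff_in_Ints_iff)
  from tj[unfolded twisted_jacobi_def, rule_format, OF this(1,2) frac_ints_numerals(1) this(3),
      where b = vac and w = w and l = "-2"]
  have "Sum_any (\<lambda>i. sM ((-1) ^ i * (of_int (-2) gchoose i))
           (YM a (m + of_int (-2) - of_nat i) (YM vac (0 + of_nat i) w)
            - sM ((-1) powi (-2)) (YM vac (0 + of_int (-2) - of_nat i) (YM a (m + of_nat i) w))))
    = Sum_any (\<lambda>i. sM (of_rat m gchoose i) (YM (Y a (-2 + int i) vac) (m + 0 - of_nat i) w))" .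
  moreover have "YM vac (0 + of_nat i) = 0" "YM vac (0 + of_int (-2) - of_nat i) = 0" for i
  proof -
    have "(0::rat) \<le> of_nat i" by simp
    then show "YM vac (0 + of_nat i) = 0" "YM vac (0 + of_int (-2) - of_nat i) = 0"
      by (auto intro!: YM_vac)
  qed
  ultimately have "0 = Sum_any (\<lambda>i. sM (of_rat m gchoose i) (YM (Y a (-2 + int i) vac) (m - of_nat i) w))"
    by simp
  also have "\<dots> = (\<Sum>i\<le>1. sM (of_rat m gchoose i) (YM (Y a (-2 + int i) vac) (m - of_nat i) w))"
    by (rule Sum_any_up_to) (simp add: vacuum_Y)
  also have "\<dots> = YM (Y \<omega> 0 a) m w + sM (of_rat m) (YM a (m - 1) w)"
    by (simp add: vacuum_Y translation_eq)
  finally show "YM (Y \<omega> 0 a) m w = op_scale sM (- of_rat m) (YM a (m - 1)) w"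
    by (simp add: op_scale_def eq_neg_iff_add_eq_0)
qed

lemma graded_Y_\<omega>: "a \<in> graded_part sV \<sigma>V T p \<Longrightarrow> Y \<omega> n a \<in> graded_part sV \<sigma>V T p"
  by (simp add: mem_graded_part \<sigma>V_Y \<sigma>V_\<omega> Y.scale)

text \<open>By linearity homogeneous vectors suffice. In the degree that matches \<open>n\<close>
  this is \<open>translation_YM_graded\<close>; in every other degree both coefficients
  vanish.\<close>

lemma translation_YM: "YM (Y \<omega> 0 a) n = op_scale sM (- of_rat n) (YM a (n - 1))"
proof (cases "n \<in> frac_ints T")
  case True
  then obtain q where q: "n = of_int q / of_nat T" by (auto simp: frac_ints_eq)
  have "YM (Y \<omega> 0 b) n = op_scale sM (- of_rat n) (YM b (n - 1))"
    if b: "b \<in> graded_part sV \<sigma>V T p" for b p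
  proof (cases "p mod int T = q mod int T")
    case True
    then have "b \<in> graded_part sV \<sigma>V T q"
      using b graded_part_mod[OF T_pos] by metis
    then show ?thesis using q by (rule translation_YM_graded)
  next
    case False
    have "n - 1 = of_int (q - int T) / of_nat T" using q by (simp add: field_simps)
    with False have "YM b (n - 1) = 0"
      using YM_not_graded[OF b, of "n - 1" "q - int T"] by simp
    then show ?thesis
      using YM_not_graded[OF graded_Y_\<omega>[OF b] q False] by simp
  qed
  note graded = this[OF graded_proj_mem[OF \<sigma>V.linear_axioms \<sigma>V_order]]
  show ?thesis
    by (subst (1 2) sum_graded_proj[OF \<sigma>V.linear_axioms \<sigma>V_order, symmetric])
       (simp add: Y.sum YM_left.sum graded op.scale_sum_right)
next
  case False
  then have "n - 1 \<notin> frac_ints T"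
    using frac_ints_add[of "n - 1" T 1] by auto
  then show ?thesis using False by (simp add: YM_not_frac)
qed

lemma YM_current:
  assumes "x \<in> graded_part sg \<sigma> T p"
  shows "YM (\<rho>V (mode x (- 1)) vac) (of_int p / of_nat T) = \<rho>M (mode x (of_int p / of_nat T))"
  using twisted_module(2) assms by (simp add: extends_twisted_currents_def graded_part_mod)

lemma current_graded:
  assumes "x \<in> graded_part sg \<sigma> T p" and "a \<in> graded_part sV \<sigma>V T q"
  shows "\<rho>V (mode x (of_int n)) a \<in> graded_part sV \<sigma>V T (p + q)"
proof -
  interpret x: Vector_Spaces.linear sV sV "\<rho>V (mode x (of_int n))"
    by (rule linear_current[OF mode_mem])
  interpret xl: Vector_Spaces.linear sg sV "\<lambda>x. \<rho>V (mode x (of_int n)) v" for v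
    by (rule linear_current_left)
  show ?thesis
    using assms by (simp add: mem_graded_part \<sigma>V_current xl.scale x.scale unit_root_add)
qed

lemma current0_graded:
  "x \<in> graded_part sg \<sigma> T p \<Longrightarrow> a \<in> graded_part sV \<sigma>V T q \<Longrightarrow> \<rho>V (mode x 0) a \<in> graded_part sV \<sigma>V T (p + q)"
  using current_graded[of x p a q 0] by simp

text \<open>On \<open>M\<close>, x(m) is a coefficient of the field of x(-1)1, and the products
  (x(-1)1)_i r in the commutator formula are the vectors x(i)r.\<close>

lemma commutator_current:
  assumes x: "x \<in> graded_part sg \<sigma> T p" and m: "m = of_int p / of_nat T" and n: "n \<in> frac_ints T"
  shows "commutator (\<rho>M (mode x m)) (YM r n) w
     = Sum_any (\<lambda>i. sM (of_rat m gchoose i) (YM (\<rho>V (mode x (of_nat i)) r) (m + n - of_nat i) w))"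
proof -
  have "\<sigma>V vac = vac" using induced by (simp add: induced_automorphism_def)
  then have "vac \<in> graded_part sV \<sigma>V T 0" by (simp add: mem_graded_part)
  then have "\<rho>V (mode x (of_int (-1))) vac \<in> graded_part sV \<sigma>V T (p + 0)"
    using x by (intro current_graded)
  then have "\<rho>V (mode x (-1)) vac \<in> graded_part sV \<sigma>V T p" by simp
  from commutator_YM[OF this m n, of r w] show ?thesis
    using x by (simp add: m YM_current current_Y)
qed

lemma commutator_current_killed:
  assumes x: "x \<in> graded_part sg \<sigma> T p" and m: "m = of_int p / of_nat T" and n: "n \<in> frac_ints T"
    and r: "killed_by_positive \<rho>V {r}"
  shows "commutator (\<rho>M (mode x m)) (YM r n) = YM (\<rho>V (mode x 0) r) (m + n)"
proof
  fix w
  have "\<rho>V (mode x (of_nat i)) r = 0" if "i \<noteq> 0" for i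
    using r that unfolding killed_by_positive_def
    by (metis gr0I of_int_of_nat_eq of_nat_0_less_iff singletonI)
  then show "commutator (\<rho>M (mode x m)) (YM r n) w = YM (\<rho>V (mode x 0) r) (m + n) w"
    by (subst commutator_current[OF x m n], subst Sum_any_only_0) simp_all
qed

lemma \<omega>_graded: "\<omega> \<in> graded_part sV \<sigma>V T 0"
  by (simp add: mem_graded_part \<sigma>V_\<omega>)

text \<open>As \<open>1 gchoose i = 0\<close> for \<open>i > 1\<close>, only the L(-1)-term and the
  L(0)-term remain; \<open>translation_YM\<close> evaluates the former at exponent
  \<open>n + 1\<close>.\<close>

lemma commutator_L0:
  assumes "n \<in> frac_ints T"
  shows "commutator (YM \<omega> 1) (YM r n) = YM (Y \<omega> 1 r) n - op_scale sM (of_rat n + 1) (YM r n)"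
proof
  fix w
  \<comment> \<open>Degree \<open>T\<close> in place of 0 makes the exponent
    \<open>of_int p / of_nat T\<close> equal to 1.\<close>
  have "\<omega> \<in> graded_part sV \<sigma>V T (int T)" using \<omega>_graded graded_part_mod[OF T_pos, of sV \<sigma>V "int T"] by simp
  from commutator_YM[OF this _ assms, of 1 r w]
  have "commutator (YM \<omega> 1) (YM r n) w
      = Sum_any (\<lambda>i. sM (1 gchoose i) (YM (Y \<omega> (int i) r) (1 + n - of_nat i) w))"
    by simp
  also have "\<dots> = (\<Sum>i\<le>1. sM (1 gchoose i) (YM (Y \<omega> (int i) r) (1 + n - of_nat i) w))"
  proof (rule Sum_any_up_to)
    fix i :: nat assume "1 < i"
    then have "(1::complex) gchoose i = 0"
      using binomial_gbinomial[of 1 i, where 'a = complex] by (simp add: binomial_eq_0)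
    then show "sM (1 gchoose i) (YM (Y \<omega> (int i) r) (1 + n - of_nat i) w) = 0" by simp
  qed
  also have "\<dots> = YM (Y \<omega> 0 r) (1 + n) w + YM (Y \<omega> 1 r) n w" by simp
  finally show "commutator (YM \<omega> 1) (YM r n) w
      = (YM (Y \<omega> 1 r) n - op_scale sM (of_rat n + 1) (YM r n)) w"
    by (simp add: translation_YM op_scale_def of_rat_add algebra_simps)
qed

lemma commutator_translation:
  assumes "n \<in> frac_ints T"
  shows "commutator (YM \<omega> 0) (YM r n) = op_scale sM (- of_rat n) (YM r (n - 1))"
proof
  fix w
  have "commutator (YM \<omega> 0) (YM r n) w
      = Sum_any (\<lambda>i. sM (0 gchoose i) (YM (Y \<omega> (int i) r) (0 + n - of_nat i) w))"
    using commutator_YM[OF \<omega>_graded _ assms, of 0 r w] by simp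
  also have "\<dots> = YM (Y \<omega> 0 r) n w"
    by (subst Sum_any_only_0) (simp_all add: gbinomial_0_left)
  finally show "commutator (YM \<omega> 0) (YM r n) w = op_scale sM (- of_rat n) (YM r (n - 1)) w"
    by (simp add: translation_YM)
qed

end

section \<open>Invariance of the conformal vector\<close>

lemma orthonormal_expand:
  assumes s: "vector_space s" and B: "orthonormal_basis s f B"
    and f: "\<And>x. Vector_Spaces.linear s (*) (f x)"
  shows "y = (\<Sum>c\<in>B. s (f c y) c)"
proof -
  interpret vector_space s by (fact s)
  have fin: "finite B" and span: "span B = UNIV"
    and on: "\<And>a b. a \<in> B \<Longrightarrow> b \<in> B \<Longrightarrow> f a b = (if a = b then 1 else 0)"
    using B by (auto simp: orthonormal_basis_def)
  interpret f: Vector_Spaces.linear s "(*)" "f x" for x by (fact f)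
  have "y \<in> span B" using span by simp
  then show ?thesis
  proof (induction rule: span_induct)
    case base
    show ?case
    proof (rule subspaceI)
      fix c x assume "x \<in> {y. y = (\<Sum>c\<in>B. s (f c y) c)}"
      then have "s c x = s c (\<Sum>b\<in>B. s (f b x) b)" by simp
      also have "\<dots> = (\<Sum>b\<in>B. s (f b (s c x)) b)"
        by (simp add: f.scale scale_sum_right)
      finally show "s c x \<in> {y. y = (\<Sum>c\<in>B. s (f c y) c)}" by simp
    qed (auto simp: f.zero f.add scale_left_distrib sum.distrib)
  next
    case (step b)
    have "(\<Sum>c\<in>B. s (f c b) c) = (\<Sum>c\<in>B. if c = b then b else 0)"
      using step on by (intro sum.cong) auto
    then show ?case using fin step by simp
  qed
qed

lemma sum_keys_single: "(\<Sum>m\<in>Poly_Mapping.keys f. Poly_Mapping.single m (Poly_Mapping.lookup f m)) = f"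
proof (rule poly_mapping_eqI)
  fix n
  have "(\<Sum>m\<in>Poly_Mapping.keys f. Poly_Mapping.lookup (Poly_Mapping.single m (Poly_Mapping.lookup f m)) n)
      = (\<Sum>m\<in>Poly_Mapping.keys f. if m = n then Poly_Mapping.lookup f n else 0)"
    by (intro sum.cong) (auto simp: lookup_single)
  also have "\<dots> = Poly_Mapping.lookup f n" by (simp add: in_keys_iff)
  finally show "Poly_Mapping.lookup (\<Sum>m\<in>Poly_Mapping.keys f. Poly_Mapping.single m (Poly_Mapping.lookup f m)) n
      = Poly_Mapping.lookup f n"
    by (simp add: lookup_sum)
qed

context twisted_current_module
begin

lemma current0_bracket:
  "\<rho>V (mode a 0) (\<rho>V (mode b (-1)) v) = \<rho>V (mode b (-1)) (\<rho>V (mode a 0) v) + \<rho>V (mode (br a b) (-1)) v"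
proof -
  have "\<rho>V (aff_bracket sg br form (mode a 0) (mode b (-1))) = commutator (\<rho>V (mode a 0)) (\<rho>V (mode b (-1)))"
    using V_module mode_mem_0[of a] mode_mem_m1[of b] unfolding lie_module_def by blast
  then have "\<rho>V (mode (br a b) (-1)) v = commutator (\<rho>V (mode a 0)) (\<rho>V (mode b (-1))) v"
    by (simp add: aff_bracket_zero_mode[OF lie])
  then show ?thesis by (simp add: commutator_def)
qed

text \<open>By invariance of the form the matrix of \<open>br a\<close> in an orthonormal basis is
  skew. The two sums that the Leibniz rule produces therefore cancel once the summation indices of
  one are exchanged.\<close>

lemma current0_conformal: "\<rho>V (mode a 0) \<omega> = 0"
proof -
  have br_lin: "Vector_Spaces.linear sg sg (\<lambda>x. br x y)" "Vector_Spaces.linear sg sg (br x)" for x y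
    using lie by (simp_all add: lie_algebra_def)
  interpret br_left: Vector_Spaces.linear sg sg "\<lambda>x. br x y" for y by (fact br_lin)
  interpret br: Vector_Spaces.linear sg sg "br x" for x by (fact br_lin)
  have form_lin: "Vector_Spaces.linear sg (*) (form x)" and form_sym: "form x y = form y x"
    and form_inv: "form (br x y) z = form x (br y z)" for x y z
    using form by (auto simp: invariant_form_def)
  interpret form: Vector_Spaces.linear sg "(*)" "form x" for x by (fact form_lin)
  have alt: "br x x = 0" for x using lie by (simp add: lie_algebra_def)
  have anti: "br y x = - br x y" for x y
  proof -
    have "br x y + br y x = 0"
      using alt[of "x + y"] unfolding br.add br_left.add by (simp add: alt add.commute)
    then show ?thesis by (simp add: eq_neg_iff_add_eq_0 add.commute)
  qed
  interpret m1: Vector_Spaces.linear sV sV "\<rho>V (mode x (-1))" for x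
    by (rule linear_current[OF mode_mem_m1])
  interpret m1_left: Vector_Spaces.linear sg sV "\<lambda>x. \<rho>V (mode x (-1)) v" for v
    using linear_current_left[of "-1" v] by simp
  let ?Q = "\<lambda>x y. \<rho>V (mode x (-1)) (\<rho>V (mode y (-1)) vac)"
  have expand: "br a b = (\<Sum>c\<in>B. sg (form c (br a b)) c)" for b
    by (rule orthonormal_expand[OF g.vector_space_axioms orthonormal form_lin])
  have skew: "form b (br a c) = - form c (br a b)" for b c
    by (metis anti form_inv form_sym form.neg)
  have 1: "?Q (br a b) b = (\<Sum>c\<in>B. sV (form c (br a b)) (?Q c b))" for b
    by (subst expand) (simp add: m1_left.sum m1_left.scale)
  have 2: "?Q b (br a b) = (\<Sum>c\<in>B. sV (form c (br a b)) (?Q b c))" for b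
    by (subst expand) (simp add: m1_left.sum m1_left.scale m1.sum m1.scale)
  have "\<rho>V (mode a 0) (\<Sum>b\<in>B. ?Q b b) = (\<Sum>b\<in>B. ?Q b (br a b)) + (\<Sum>b\<in>B. ?Q (br a b) b)"
    by (simp add: current0.sum current0_bracket current0_vac m1.add m1.zero sum.distrib)
  also have "(\<Sum>b\<in>B. ?Q b (br a b)) = (\<Sum>c\<in>B. \<Sum>b\<in>B. sV (form c (br a b)) (?Q b c))"
    unfolding 2 by (rule sum.swap)
  also have "\<dots> = - (\<Sum>b\<in>B. ?Q (br a b) b)"
    unfolding 1 sum_negf[symmetric]
    by (intro sum.cong refl) (metis skew V.scale_minus_left)
  finally show ?thesis
    by (simp add: conformal_vector sugawara_def current0.scale)
qed

text \<open>x(0) is the coefficient at index 0 of the field of x(-1)1, so its commutator with L(0)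
  involves only x(0)\<omega> = 0.\<close>

lemma L0_current0: "Y \<omega> 1 (\<rho>V (mode x 0) v) = \<rho>V (mode x 0) (Y \<omega> 1 v)"
proof -
  have "\<rho>V (mode x 0) (Y \<omega> 1 v) - Y \<omega> 1 (\<rho>V (mode x 0) v)
      = Sum_any (\<lambda>i. sV (0 gchoose i) (Y (\<rho>V (mode x (of_nat i)) \<omega>) (1 - int i) v))"
    using commutator_Y[of "\<rho>V (mode x (-1)) vac" 0 \<omega> 1 v] by (simp add: current_Y)
  also have "\<dots> = 0"
    by (subst Sum_any_only_0) (simp_all add: gbinomial_0_left current0_conformal)
  finally show ?thesis by simp
qed

section \<open>The adjoint action in terms of modes\<close>

lemma M_linear: "X \<in> twisted_affine sg \<sigma> T \<Longrightarrow> Vector_Spaces.linear sM sM (\<rho>M X)"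
  and M_add: "X \<in> twisted_affine sg \<sigma> T \<Longrightarrow> X' \<in> twisted_affine sg \<sigma> T \<Longrightarrow> \<rho>M (X + X') = \<rho>M X + \<rho>M X'"
  and M_scale: "X \<in> twisted_affine sg \<sigma> T \<Longrightarrow> \<rho>M (aff_scale sg c X) = op_scale sM c (\<rho>M X)"
  using M_module by (simp_all add: lie_module_def)

lemma graded_part_subspace: "g.subspace (graded_part sg \<sigma> T j)"
  by (auto intro!: g.subspaceI simp: mem_graded_part \<sigma>.add \<sigma>.scale g.scale_right_distrib mult.commute)

lemma twisted_affine_add:
  assumes "X \<in> twisted_affine sg \<sigma> T" and "X' \<in> twisted_affine sg \<sigma> T"
  shows "X + X' \<in> twisted_affine sg \<sigma> T"
proof -
  obtain f \<alpha> \<beta> f' \<alpha>' \<beta>' where X: "X = (f, \<alpha>, \<beta>)" "X' = (f', \<alpha>', \<beta>')" by (metis prod_cases3)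
  \<comment> \<open>Off the keys the coefficient is 0, which lies in every eigenspace, so this holds
    for all \<open>m\<close>.\<close>
  have "Poly_Mapping.lookup f m \<in> graded_part sg \<sigma> T (residue T m)"
       "Poly_Mapping.lookup f' m \<in> graded_part sg \<sigma> T (residue T m)" for m
    using assms g.subspace_0[OF graded_part_subspace, of "residue T m"]
    by (cases "m \<in> Poly_Mapping.keys f"; cases "m \<in> Poly_Mapping.keys f'";
        force simp: X twisted_affine_def in_keys_iff)+
  moreover have "m \<in> frac_ints T" if "m \<in> Poly_Mapping.keys (f + f')" for m
    using assms that Poly_Mapping.keys_add[of f f'] by (auto simp: X twisted_affine_def)
  ultimately show ?thesis
    using graded_part_subspace by (auto simp: X twisted_affine_def lookup_add intro: g.subspace_add)
qed

lemma M_zero: "\<rho>M 0 = 0" and zero_mem_twisted_affine: "0 \<in> twisted_affine sg \<sigma> T"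
proof -
  show *: "0 \<in> twisted_affine sg \<sigma> T" by (simp add: twisted_affine_def zero_prod_def)
  from M_add[OF * *] show "\<rho>M 0 = 0" by simp
qed

lemma M_sum:
  assumes "\<And>i. i \<in> I \<Longrightarrow> X i \<in> twisted_affine sg \<sigma> T"
  shows "\<rho>M (\<Sum>i\<in>I. X i) = (\<Sum>i\<in>I. \<rho>M (X i)) \<and> (\<Sum>i\<in>I. X i) \<in> twisted_affine sg \<sigma> T"
  using assms
  by (induction I rule: infinite_finite_induct)
     (auto simp: M_zero zero_mem_twisted_affine M_add twisted_affine_add)

lemma aff_c_mem: "aff_c \<in> twisted_affine sg \<sigma> T"
  by (simp add: twisted_affine_def aff_c_def)

lemma aff_scale_aff_c: "aff_scale sg \<alpha> aff_c = (0, \<alpha>, 0)"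
  by (auto simp: aff_scale_def aff_c_def map.rep_eq intro!: poly_mapping_eqI)

lemma M_decompose:
  assumes "(f, \<alpha>, \<beta>) \<in> twisted_affine sg \<sigma> T"
  shows "\<rho>M (f, \<alpha>, 0) = (\<Sum>m\<in>Poly_Mapping.keys f. \<rho>M (mode (Poly_Mapping.lookup f m) m)) + op_scale sM \<alpha> (sM k)"
proof -
  let ?X = "\<Sum>m\<in>Poly_Mapping.keys f. mode (Poly_Mapping.lookup f m) m"
  have mem: "mode (Poly_Mapping.lookup f m) m \<in> twisted_affine sg \<sigma> T" if "m \<in> Poly_Mapping.keys f" for m
    using assms that by (intro mode_mem_twisted_affine) (auto simp: twisted_affine_def)
  have "?X = (f, 0, 0)"
    by (simp add: prod_eq_iff fst_sum snd_sum mode_def sum_keys_single)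
  then have "(f, \<alpha>, 0) = ?X + aff_scale sg \<alpha> aff_c"
    by (simp add: aff_scale_aff_c)
  moreover have "aff_scale sg \<alpha> aff_c \<in> twisted_affine sg \<sigma> T"
    by (simp add: aff_scale_aff_c twisted_affine_def)
  ultimately show ?thesis
    using M_sum[of "Poly_Mapping.keys f" "\<lambda>m. mode (Poly_Mapping.lookup f m) m"] mem
    by (simp add: M_add M_scale aff_c_mem level)
qed

lemma mode_mem_M:
  "x \<in> graded_part sg \<sigma> T p \<Longrightarrow> mode x (of_int p / of_nat T) \<in> twisted_affine sg \<sigma> T"
  by (rule mode_mem_twisted_affine) (simp_all add: graded_part_mod)

lemma twisted_affine_coeff:
  assumes "(f, \<alpha>, \<beta>) \<in> twisted_affine sg \<sigma> T" and "m \<in> Poly_Mapping.keys f"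
  obtains p where "m = of_int p / of_nat T" and "Poly_Mapping.lookup f m \<in> graded_part sg \<sigma> T p"
proof -
  have "m \<in> frac_ints T" "Poly_Mapping.lookup f m \<in> graded_part sg \<sigma> T (residue T m)"
    using assms by (auto simp: twisted_affine_def)
  moreover from this(1) obtain p where "m = of_int p / of_nat T" by (auto simp: frac_ints_eq)
  ultimately show ?thesis
    using that[of p] by (simp add: graded_part_mod)
qed

lemma commutator_adjoint:
  assumes X: "(f, \<alpha>, \<beta>) \<in> twisted_affine sg \<sigma> T" and n: "n \<in> frac_ints T"
    and r: "killed_by_positive \<rho>V {r}"
  shows "commutator (\<rho>M (f, \<alpha>, 0) - op_scale sM \<beta> (YM \<omega> 1)) (YM r n)
    = (\<Sum>m\<in>Poly_Mapping.keys f. YM (\<rho>V (mode (Poly_Mapping.lookup f m) 0) r) (m + n))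
      - op_scale sM \<beta> (YM (Y \<omega> 1 r) n - op_scale sM (of_rat n + 1) (YM r n))"
proof -
  have "commutator (\<rho>M (mode (Poly_Mapping.lookup f m) m)) (YM r n)
      = YM (\<rho>V (mode (Poly_Mapping.lookup f m) 0) r) (m + n)" if "m \<in> Poly_Mapping.keys f" for m
    using X that n r by (metis twisted_affine_coeff commutator_current_killed)
  moreover have "commutator (sM k) (YM r n) = 0"
    by (simp add: commutator_def fun_eq_iff YM.scale)
  ultimately show ?thesis
    by (simp add: M_decompose[OF X] commutator_diff_left[OF YM.linear_axioms]
        commutator_add_left[OF YM.linear_axioms] commutator_sum_left[OF YM.linear_axioms]
        commutator_op_scale_left[OF YM.linear_axioms] commutator_L0[OF n])
qed

lemma adjoint_operator_linear:
  assumes "(f, \<alpha>, \<beta>) \<in> twisted_affine sg \<sigma> T"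
  shows "Vector_Spaces.linear (op_scale sM) (op_scale sM)
    (commutator (\<rho>M (f, \<alpha>, 0) - op_scale sM \<beta> (YM \<omega> 1)))"
proof -
  have "(f, \<alpha>, 0) \<in> twisted_affine sg \<sigma> T"
    using assms by (auto simp: twisted_affine_def)
  then show ?thesis
    by (intro linear_commutator linear_op_diff M_linear linear_op_scale YM.linear_axioms)
qed

lemma current_mem_adjoint_ops:
  assumes x: "x \<in> graded_part sg \<sigma> T p"
  shows "commutator (\<rho>M (mode x (of_int p / of_nat T))) \<in> adjoint_ops sg \<sigma> T sM \<rho>M YM \<omega>"
  using mode_mem_M[OF x] unfolding adjoint_ops_def mode_def
  by (intro CollectI exI[of _ "Poly_Mapping.single (of_int p / of_nat T) x"] exI[of _ 0])
     (simp add: op_scale_def flip: zero_fun_def)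

lemma stable_under_adjoint_current:
  assumes "stable_under (adjoint_ops sg \<sigma> T sM \<rho>M YM \<omega>) U" and "u \<in> U"
    and x: "x \<in> graded_part sg \<sigma> T p"
  shows "commutator (\<rho>M (mode x (of_int p / of_nat T))) u \<in> U"
  using current_mem_adjoint_ops[OF x] assms(1,2) by (auto simp: stable_under_def)

lemma stable_under_adjoint_L0:
  assumes "stable_under (adjoint_ops sg \<sigma> T sM \<rho>M YM \<omega>) U"
  shows "commutator (YM \<omega> 1) ` U \<subseteq> U"
proof -
  \<comment> \<open>\<open>d\<close> is represented by -L(0), so L(0) itself arises from the
    coefficient -1.\<close>
  have "\<rho>M (0, 0, 0) - op_scale sM (- 1) (YM \<omega> 1) = YM \<omega> 1"
    using M_zero by (simp add: zero_prod_def op_scale_def fun_eq_iff)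
  then have "commutator (YM \<omega> 1) \<in> adjoint_ops sg \<sigma> T sM \<rho>M YM \<omega>"
    unfolding adjoint_ops_def
    by (intro CollectI exI[of _ 0] exI[of _ "- 1"]) (simp add: twisted_affine_def)
  then show ?thesis using assms by (auto simp: stable_under_def)
qed

section \<open>Coefficient spaces\<close>

abbreviation "coeffs \<equiv> coeff_space sM YM T"
abbreviation "adj_ops \<equiv> adjoint_ops sg \<sigma> T sM \<rho>M YM \<omega>"

lemma coeff_mem: "r \<in> W \<Longrightarrow> n \<in> frac_ints T \<Longrightarrow> YM r n \<in> coeffs W"
  unfolding coeff_space_def by (rule op.span_base) blast

lemma coeffs_subspace: "op.subspace (coeffs W)"
  by (simp add: coeff_space_def)

lemma coeffs_mono: "W \<subseteq> W' \<Longrightarrow> coeffs W \<subseteq> coeffs W'"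
  unfolding coeff_space_def by (rule op.span_mono) blast

lemma coeffs_minimal:
  assumes "op.subspace U" and "\<And>r n. r \<in> W \<Longrightarrow> n \<in> frac_ints T \<Longrightarrow> YM r n \<in> U"
  shows "coeffs W \<subseteq> U"
  unfolding coeff_space_def using assms by (intro op.span_minimal) auto

lemma killed_mono: "killed_by_positive \<rho>V R \<Longrightarrow> W \<subseteq> R \<Longrightarrow> killed_by_positive \<rho>V W"
  unfolding killed_by_positive_def by blast

lemma killed_singleton: "killed_by_positive \<rho>V R \<Longrightarrow> r \<in> R \<Longrightarrow> killed_by_positive \<rho>V {r}"
  by (rule killed_mono) auto

text \<open>The adjoint operators are linear, so generators suffice, and
  \<open>commutator_adjoint\<close> expresses the image of \<open>YM r n\<close> by coefficients of
  x(0)r, L(0)r and r.\<close>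

lemma coeffs_stable:
  assumes W: "V.subspace W" "stable_under (g_ops \<rho>V) W" "Y \<omega> 1 ` W \<subseteq> W" and "killed_by_positive \<rho>V W"
  shows "stable_under adj_ops (coeffs W)"
proof -
  have "commutator (\<rho>M (f, \<alpha>, 0) - op_scale sM \<beta> (YM \<omega> 1)) u \<in> coeffs W"
    if X: "(f, \<alpha>, \<beta>) \<in> twisted_affine sg \<sigma> T" and u: "u \<in> coeffs W" for f \<alpha> \<beta> u
  proof -
    interpret A: Vector_Spaces.linear "op_scale sM" "op_scale sM"
      "commutator (\<rho>M (f, \<alpha>, 0) - op_scale sM \<beta> (YM \<omega> 1))"
      by (rule adjoint_operator_linear[OF X])
    have gen: "commutator (\<rho>M (f, \<alpha>, 0) - op_scale sM \<beta> (YM \<omega> 1)) (YM r n) \<in> coeffs W"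
      if r: "r \<in> W" and n: "n \<in> frac_ints T" for r n
    proof -
      have "YM (\<rho>V (mode (Poly_Mapping.lookup f m) 0) r) (m + n) \<in> coeffs W"
        if "m \<in> Poly_Mapping.keys f" for m
        using W(2) r n X that
        by (intro coeff_mem frac_ints_add) (auto simp: stable_under_def g_ops_def twisted_affine_def)
      moreover have "YM (Y \<omega> 1 r) n \<in> coeffs W" "YM r n \<in> coeffs W"
        using W(3) r n by (auto intro: coeff_mem)
      ultimately show ?thesis
        unfolding commutator_adjoint[OF X n killed_singleton[OF assms(4) r]]
        by (intro op.subspace_diff op.subspace_sum op.subspace_scale coeffs_subspace)
    qed
    have "coeffs W \<subseteq> {u. commutator (\<rho>M (f, \<alpha>, 0) - op_scale sM \<beta> (YM \<omega> 1)) u \<in> coeffs W}"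
      using gen by (intro coeffs_minimal A.subspace_linear_preimage coeffs_subspace) simp
    then show ?thesis using u by blast
  qed
  then show ?thesis by (auto simp: stable_under_def adjoint_ops_def)
qed

section \<open>The loop formula and annihilation by positive modes\<close>

lemma loop_formula_of_killed:
  assumes "killed_by_positive \<rho>V R"
  shows "loop_formula sg \<sigma> T \<rho>V \<rho>M YM R"
  unfolding loop_formula_def
proof (intro ballI)
  fix m n x r
  assume "m \<in> frac_ints T" "n \<in> frac_ints T" "x \<in> graded_part sg \<sigma> T (residue T m)" "r \<in> R"
  moreover from this(1) obtain p where "m = of_int p / of_nat T" by (auto simp: frac_ints_eq)
  ultimately show "commutator (\<rho>M (mode x m)) (YM r n) = YM (\<rho>V (mode x 0) r) (m + n)"
    using assms by (intro commutator_current_killed killed_singleton) (auto simp: graded_part_mod)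
qed

lemma loop_formulaD:
  assumes "loop_formula sg \<sigma> T \<rho>V \<rho>M YM R" and "x \<in> graded_part sg \<sigma> T p"
    and "n \<in> frac_ints T" and "r \<in> R"
  shows "commutator (\<rho>M (mode x (of_int p / of_nat T))) (YM r n)
    = YM (\<rho>V (mode x 0) r) (of_int p / of_nat T + n)"
  using assms by (simp add: loop_formula_def graded_part_mod)

lemma faithful_eq_0:
  assumes "faithful YM" and "\<And>n. n \<in> frac_ints T \<Longrightarrow> YM v n = 0"
  shows "v = 0"
  using assms(1) unfolding faithful_def by (metis assms(2) YM_not_frac)

lemma sum_current_proj:
  "(\<Sum>j<T. \<rho>V (mode (graded_proj sg \<sigma> T j x) (of_int n)) v) = \<rho>V (mode x (of_int n)) v"
proof -
  interpret xl: Vector_Spaces.linear sg sV "\<lambda>x. \<rho>V (mode x (of_int n)) v"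
    by (rule linear_current_left)
  show ?thesis
    by (simp add: sum_graded_proj[OF \<sigma>.linear_axioms automorphism(2)] flip: xl.sum)
qed

text \<open>
  With \<open>m + n\<close> fixed, the extra terms \<open>(m choose i) (x(i)r)\<^bsub>m+n-i\<^esub>\<close> with \<open>i \<ge> 1\<close> form a polynomial in \<open>m\<close>
  that vanishes on a coset of \<open>\<int>\<close>.
\<close>

lemma killed_of_loop_formula:
  assumes faithful: "faithful YM" and loop: "loop_formula sg \<sigma> T \<rho>V \<rho>M YM R"
  shows "killed_by_positive \<rho>V R"
proof -
  have graded: "\<rho>V (mode x (of_int (int i))) r = 0"
    if x: "x \<in> graded_part sg \<sigma> T p" and r: "r \<in> R" and i: "0 < i" for x p r i
  proof (rule faithful_eq_0[OF faithful])
    fix n assume n: "n \<in> frac_ints T"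
    show "YM (\<rho>V (mode x (of_int (int i))) r) n = 0"
    proof
      fix w
      let ?a = "\<lambda>i. \<rho>V (mode x (of_nat i)) r"
      have "truncated Y" using vertex_algebra(1) by (simp add: voa_def)
      then obtain N where N: "\<And>l. N \<le> l \<Longrightarrow> Y (\<rho>V (mode x (-1)) vac) l r = 0"
        unfolding truncated_def by metis
      \<comment> \<open>Beyond \<open>nat N\<close> the vectors x(l)r vanish by truncation;
        \<open>i\<close> is included so that \<open>v i\<close> is among the coefficients shown to
        be 0.\<close>
      define K where "K = max i (nat N)"
      have a_0: "?a l = 0" if "K < l" for l
      proof -
        have "N \<le> int l" using that unfolding K_def by linarith
        then show ?thesis using N[of "int l"] by (simp add: current_Y)
      qed
      \<comment> \<open>The loop formula cancels the term \<open>l = 0\<close>, hence the value 0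
        there. The exponents are arranged so that \<open>v i\<close> is the coefficient at
        \<open>n\<close>.\<close>
      define v where "v l = (if l = 0 then 0 else YM (?a l) (n + of_nat i - of_nat l) w)" for l
      have "(\<Sum>l\<le>K. sM ((of_rat (of_int p / of_nat T) + of_nat c) gchoose l) (v l)) = 0" for c :: nat
      proof -
        \<comment> \<open>Adding a multiple of \<open>T\<close> keeps the degree of \<open>x\<close>
          and raises the exponent by \<open>c\<close>.\<close>
        let ?p = "p + int T * int c"
        define m where "m = (of_int ?p / of_nat T :: rat)"
        have m_eq: "m = of_int p / of_nat T + of_nat c"
          by (simp add: m_def add_divide_distrib)
        have xp: "x \<in> graded_part sg \<sigma> T ?p"
          using x graded_part_mod[OF T_pos] mod_mult_self2[of p "int T" "int c"] by metis
        \<comment> \<open>This keeps \<open>m + q\<close> equal to \<open>n + of_nat i\<close>, so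
          that the \<open>v l\<close> do not depend on \<open>c\<close>.\<close>
        define q where "q = n + of_nat i - m"
        have q: "q \<in> frac_ints T"
          unfolding q_def m_def using n of_int_mem_frac_ints[of "int i" T]
          by (intro frac_ints_diff frac_ints_add of_int_div_mem_frac_ints T_pos) simp_all
        have "YM (\<rho>V (mode x 0) r) (m + q) w = commutator (\<rho>M (mode x m)) (YM r q) w"
          using loop_formulaD[OF loop xp q r] by (simp only: m_def)
        also have "\<dots> = Sum_any (\<lambda>l. sM (of_rat m gchoose l) (YM (?a l) (m + q - of_nat l) w))"
          by (rule commutator_current[OF xp m_def q])
        also have "\<dots> = (\<Sum>l\<le>K. sM (of_rat m gchoose l) (YM (?a l) (m + q - of_nat l) w))"
          by (rule Sum_any_up_to) (simp add: a_0)
        also have "\<dots> = (\<Sum>l\<le>K. (if l = 0 then YM (\<rho>V (mode x 0) r) (m + q) w else 0)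
            + sM (of_rat m gchoose l) (v l))"
          by (intro sum.cong) (auto simp: v_def q_def)
        also have "\<dots> = YM (\<rho>V (mode x 0) r) (m + q) w + (\<Sum>l\<le>K. sM (of_rat m gchoose l) (v l))"
          by (simp add: sum.distrib)
        finally show ?thesis by (simp add: m_eq of_rat_add)
      qed
      then have "\<forall>l\<le>K. v l = 0"
        by (rule gbinomial_combination_eq_0[OF M.vector_space_axioms])
      then have "v i = 0" by (simp add: K_def)
      then show "YM (\<rho>V (mode x (of_int (int i))) r) n w = 0 w"
        using i by (simp add: v_def)
    qed
  qed
  show ?thesis
    unfolding killed_by_positive_def
  proof (intro allI impI ballI)
    fix n :: int and x r assume n: "0 < n" and r: "r \<in> R"
    have "\<rho>V (mode (graded_proj sg \<sigma> T j x) (of_int n)) r = 0" for j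
      using graded[OF graded_proj_mem[OF \<sigma>.linear_axioms automorphism(2)] r, of "nat n"] n by simp
    then show "\<rho>V (mode x (of_int n)) r = 0"
      using sum_current_proj[of x n r] by simp
  qed
qed

section \<open>Homogeneous components\<close>

text \<open>Indexed by all integers, periodically modulo \<open>T\<close>, to match exponents
  written as \<open>of_int q / of_nat T\<close>.\<close>

definition hom_part :: "int \<Rightarrow> 'v \<Rightarrow> 'v" where
  "hom_part q = graded_proj sV \<sigma>V T (nat (q mod int T))"

lemma hom_part_graded: "hom_part q a \<in> graded_part sV \<sigma>V T q"
  using graded_proj_mem[OF \<sigma>V.linear_axioms \<sigma>V_order, of "nat (q mod int T)" a]
  by (simp add: hom_part_def graded_part_mod)

lemma hom_part_mem: "V.subspace W \<Longrightarrow> \<sigma>V ` W \<subseteq> W \<Longrightarrow> a \<in> W \<Longrightarrow> hom_part q a \<in> W"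
  unfolding hom_part_def by (rule graded_proj_subspace[OF V.vector_space_axioms])

lemma sum_hom_part: "(\<Sum>j<T. hom_part (int j) a) = a"
  using sum_graded_proj[OF \<sigma>V.linear_axioms \<sigma>V_order, of a] by (simp add: hom_part_def)

text \<open>The other homogeneous components have zero coefficient at this exponent. Any coefficient
  thus comes from a homogeneous vector of the matching degree.\<close>

lemma YM_hom_part:
  assumes "n = of_int q / of_nat T"
  shows "YM (hom_part q a) n = YM a n"
proof -
  let ?j = "nat (q mod int T)"
  have "YM a n = (\<Sum>j<T. YM (hom_part (int j) a) n)"
    by (subst sum_hom_part[symmetric]) (rule YM_left.sum)
  also have "\<dots> = (\<Sum>j<T. if j = ?j then YM (hom_part q a) n else 0)"
  proof (intro sum.cong refl)
    fix j assume j: "j \<in> {..<T}"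
    show "YM (hom_part (int j) a) n = (if j = ?j then YM (hom_part q a) n else 0)"
    proof (cases "j = ?j")
      case True
      then show ?thesis by (simp add: hom_part_def)
    next
      case False
      then have "int j mod int T \<noteq> q mod int T" using j by auto
      then show ?thesis using False YM_not_graded[OF hom_part_graded assms] by simp
    qed
  qed
  also have "\<dots> = YM (hom_part q a) n"
    by (simp add: nat_less_iff)
  finally show ?thesis by simp
qed

text \<open>
  For homogeneous vectors a relation between two coefficients propagates, after applying \<open>x(0)\<close>, to
  all coefficients: \<open>[x(m), \<cdot>]\<close> moves the exponent by an arbitrary element \<open>m\<close> of a coset of \<open>\<int>\<close>, and
  outside this coset the coefficients of \<open>x(0)u\<close> vanish.
\<close>

lemma current_shift:
  assumes U: "op.subspace U"
    and closed: "\<And>x p z. x \<in> graded_part sg \<sigma> T p \<Longrightarrow> z \<in> U \<Longrightarrow>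
      commutator (\<rho>M (mode x (of_int p / of_nat T))) z \<in> U"
    and u: "u \<in> graded_part sV \<sigma>V T q" "killed_by_positive \<rho>V {u}"
    and v: "v \<in> graded_part sV \<sigma>V T q" "killed_by_positive \<rho>V {v}"
    and diff: "YM u (of_int q / of_nat T) - YM v (of_int q / of_nat T + of_int d) \<in> U"
  shows "YM (\<rho>V (mode x 0) u) n - YM (\<rho>V (mode x 0) v) (n + of_int d) \<in> U"
proof (cases "n \<in> frac_ints T")
  case True
  then obtain q' where n: "n = of_int q' / of_nat T" by (auto simp: frac_ints_eq)
  have nd: "n + of_int d = of_int (q' + d * int T) / of_nat T" by (simp add: n field_simps)
  have hom: "YM (\<rho>V (mode x 0) u) n - YM (\<rho>V (mode x 0) v) (n + of_int d) \<in> U"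
    if x: "x \<in> graded_part sg \<sigma> T p" for x p
  proof (cases "(p + q) mod int T = q' mod int T")
    case True
    \<comment> \<open>The exponent that carries q/T to \<open>n\<close>; the congruence of degrees
      gives \<open>x\<close> the degree that \<open>mode x m\<close> requires.\<close>
    define m where "m = (of_int (q' - q) / of_nat T :: rat)"
    have "(q' - q) mod int T = p mod int T"
    proof -
      have "int T dvd p + q - q'" using True by (simp add: mod_eq_dvd_iff)
      then have "int T dvd q' - (p + q)" by (metis dvd_diff_commute)
      then show ?thesis by (simp add: mod_eq_dvd_iff algebra_simps)
    qed
    then have x': "x \<in> graded_part sg \<sigma> T (q' - q)"
      using x graded_part_mod[OF T_pos] by metis
    interpret c: Vector_Spaces.linear "op_scale sM" "op_scale sM" "commutator (\<rho>M (mode x m))"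
      unfolding m_def by (intro linear_commutator M_linear mode_mem_M x')
    have "commutator (\<rho>M (mode x m)) (YM u (of_int q / of_nat T) - YM v (of_int q / of_nat T + of_int d)) \<in> U"
      unfolding m_def by (rule closed[OF x' diff])
    moreover have "m + of_int q / of_nat T = n" "m + (of_int q / of_nat T + of_int d) = n + of_int d"
      by (simp_all add: m_def n diff_divide_distrib)
    ultimately show ?thesis
      unfolding c.diff
      by (simp add: commutator_current_killed[OF x' m_def _ u(2)]
          commutator_current_killed[OF x' m_def _ v(2)] frac_ints_add)
  next
    case False
    have "YM (\<rho>V (mode x 0) u) n = 0"
      using False by (rule YM_not_graded[OF current0_graded[OF x u(1)] n])
    moreover have "YM (\<rho>V (mode x 0) v) (n + of_int d) = 0"
      using False by (intro YM_not_graded[OF current0_graded[OF x v(1)] nd]) simp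
    ultimately show ?thesis using U op.subspace_0 by simp
  qed
  let ?x = "\<lambda>j. graded_proj sg \<sigma> T j x"
  have "(\<Sum>j<T. YM (\<rho>V (mode (?x j) 0) u) n - YM (\<rho>V (mode (?x j) 0) v) (n + of_int d)) \<in> U"
    using U hom[OF graded_proj_mem[OF \<sigma>.linear_axioms automorphism(2)]] by (intro op.subspace_sum) auto
  then show ?thesis
    using sum_current_proj[of x 0 u] sum_current_proj[of x 0 v]
    by (simp add: sum_subtractf flip: YM_left.sum)
next
  case False
  then have "n + of_int d \<notin> frac_ints T"
    using frac_ints_diff[of "n + of_int d" T "of_int d"] by auto
  then show ?thesis using False U op.subspace_0 by (simp add: YM_not_frac)
qed

text \<open>For fixed \<open>n\<close> the operators \<open>YM r n\<close> with \<open>r\<close> in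
  the subspace \<open>W\<close> form a subspace, so terms with equal exponents merge into one
  coefficient.\<close>

lemma coeffs_expansion:
  assumes W: "V.subspace W" and u: "u \<in> coeffs W"
  shows "\<exists>F w. finite F \<and> F \<subseteq> frac_ints T \<and> (\<forall>n\<in>F. w n \<in> W) \<and> u = (\<Sum>n\<in>F. YM (w n) n)"
proof -
  have "{YM r n | r n. r \<in> W \<and> n \<in> frac_ints T} = (\<Union>n\<in>frac_ints T. (\<lambda>r. YM r n) ` W)"
    by blast
  then obtain F w where F: "finite F" "F \<subseteq> frac_ints T" "\<forall>n\<in>F. w n \<in> (\<lambda>r. YM r n) ` W" "u = (\<Sum>n\<in>F. w n)"
    using op.span_UN_subspaces[of "frac_ints T" "\<lambda>n. (\<lambda>r. YM r n) ` W" u] u YM_left.subspace_image[OF W]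
    by (auto simp: coeff_space_def)
  from F(3) obtain w' where "\<forall>n\<in>F. w' n \<in> W \<and> w n = YM (w' n) n"
    unfolding image_iff by metis
  with F show ?thesis by (intro exI[of _ F] exI[of _ w']) auto
qed

lemma commutator_L0_eigen:
  assumes "Y \<omega> 1 r = sV h r" and "n \<in> frac_ints T"
  shows "commutator (YM \<omega> 1) (YM r n) = op_scale sM (h - 1 - of_rat n) (YM r n)"
proof -
  have "commutator (YM \<omega> 1) (YM r n) = op_scale sM h (YM r n) - op_scale sM (of_rat n + 1) (YM r n)"
    using assms by (simp add: commutator_L0 YM_left.scale)
  also have "\<dots> = op_scale sM (h - (of_rat n + 1)) (YM r n)"
    by (rule op.scale_left_diff_distrib[symmetric])
  finally show ?thesis by (simp add: algebra_simps)
qed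

lemma commutator_\<omega>_linear:
  "Vector_Spaces.linear (op_scale sM) (op_scale sM) (commutator (YM \<omega> n))"
  by (intro linear_commutator YM.linear_axioms)

lemma inj_on_weight: "inj_on (\<lambda>n. h - 1 - of_rat n :: complex) F"
  by (auto simp: inj_on_def)

text \<open>On vectors of a single weight \<open>h\<close> the ad L(0)-eigenvalue
  \<open>h - 1 - n\<close> determines the exponent, so an eigenvector is one coefficient. The zero
  operator is represented by \<open>w = 0\<close>.\<close>

lemma coeffs_eigenvector:
  assumes W: "V.subspace W" "\<And>w. w \<in> W \<Longrightarrow> Y \<omega> 1 w = sV h w"
    and u: "u \<in> coeffs W" "commutator (YM \<omega> 1) u = op_scale sM (h - 1 - of_rat n) u"
  obtains w where "w \<in> W" "u = YM w n"
proof -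
  obtain F w where F: "finite F" "F \<subseteq> frac_ints T" "\<forall>n\<in>F. w n \<in> W" "u = (\<Sum>n\<in>F. YM (w n) n)"
    using coeffs_expansion[OF W(1) u(1)] by (elim exE conjE)
  have "u = 0 \<or> (\<exists>n'\<in>F. h - 1 - of_rat n' = h - 1 - of_rat n \<and> u = YM (w n') n')"
  proof (rule op.eigenvector_in_eigen_sum[OF commutator_\<omega>_linear F(1) _ inj_on_weight F(4) u(2)])
    show "commutator (YM \<omega> 1) (YM (w n') n') = op_scale sM (h - 1 - of_rat n') (YM (w n') n')"
      if "n' \<in> F" for n'
      using that F(2,3) W(2) by (intro commutator_L0_eigen) auto
  qed
  then show ?thesis
  proof
    assume "u = 0"
    then show ?thesis using that[of 0] V.subspace_0[OF W(1)] by simp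
  next
    assume "\<exists>n'\<in>F. h - 1 - of_rat n' = h - 1 - of_rat n \<and> u = YM (w n') n'"
    then obtain n' where "n' \<in> F" "n' = n" "u = YM (w n') n'" by auto
    then show ?thesis using that F(3) by blast
  qed
qed

text \<open>A subspace stable under ad L(0) contains the eigencomponents of its elements, and these
  are single coefficients.\<close>

lemma coeffs_homogeneous_member:
  assumes W: "V.subspace W" "\<And>w. w \<in> W \<Longrightarrow> Y \<omega> 1 w = sV h w"
    and U: "op.subspace U" "U \<subseteq> coeffs W" "U \<noteq> {0}" "commutator (YM \<omega> 1) ` U \<subseteq> U"
  obtains w n where "w \<in> W" "n \<in> frac_ints T" "YM w n \<in> U" "YM w n \<noteq> 0"
proof -
  obtain u where u: "u \<in> U" "u \<noteq> 0" using U(1,3) op.subspace_0 by blast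
  from u(1) U(2) have "u \<in> coeffs W" by blast
  from coeffs_expansion[OF W(1) this] obtain F w where
    F: "finite F" "F \<subseteq> frac_ints T" "\<forall>n\<in>F. w n \<in> W" "u = (\<Sum>n\<in>F. YM (w n) n)"
    by (elim exE conjE)
  have "\<forall>n\<in>F. YM (w n) n \<in> U"
  proof (rule op.eigen_components_mem[OF U(1) commutator_\<omega>_linear U(4) F(1) _ inj_on_weight])
    show "commutator (YM \<omega> 1) (YM (w n) n) = op_scale sM (h - 1 - of_rat n) (YM (w n) n)"
      if "n \<in> F" for n
      using that F(2,3) W(2) by (intro commutator_L0_eigen) auto
    show "(\<Sum>n\<in>F. YM (w n) n) \<in> U" using u(1) F(4) by simp
  qed
  moreover have "\<exists>n\<in>F. YM (w n) n \<noteq> 0"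
    using u(2) unfolding F(4) by (meson sum.neutral)
  ultimately show ?thesis
    using that F(2,3) by (meson subsetD)
qed

section \<open>Weights and invariants\<close>

definition weight_part :: "'v set \<Rightarrow> int \<Rightarrow> 'v set" where
  "weight_part W h = {w \<in> W. Y \<omega> 1 w = sV (of_int h) w}"

definition invariants :: "'v set \<Rightarrow> 'v set" where
  "invariants W = {w \<in> W. \<forall>x. \<rho>V (mode x 0) w = 0}"

lemma current0_mem: "stable_under (g_ops \<rho>V) W \<Longrightarrow> w \<in> W \<Longrightarrow> \<rho>V (mode x 0) w \<in> W"
  by (auto simp: stable_under_def g_ops_def)

lemma stable_g_opsI: "(\<And>x w. w \<in> W \<Longrightarrow> \<rho>V (mode x 0) w \<in> W) \<Longrightarrow> stable_under (g_ops \<rho>V) W"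
  by (auto simp: stable_under_def g_ops_def)

lemma weight_part_subspace: "V.subspace W \<Longrightarrow> V.subspace (weight_part W h)"
  by (auto simp: weight_part_def V.subspace_def Y.add Y.scale V.scale_right_distrib mult.commute)

lemma weight_partD: "w \<in> weight_part W h \<Longrightarrow> Y \<omega> 1 w = sV (of_int h) w"
  by (simp add: weight_part_def)

lemma weight_part_stable: "stable_under (g_ops \<rho>V) W \<Longrightarrow> stable_under (g_ops \<rho>V) (weight_part W h)"
  by (rule stable_g_opsI) (auto simp: weight_part_def current0_mem L0_current0 current0.scale)

lemma weight_part_L0: "V.subspace W \<Longrightarrow> Y \<omega> 1 ` weight_part W h \<subseteq> weight_part W h"
  by (auto simp: weight_part_def Y.scale V.subspace_scale)

lemma weight_part_\<sigma>V: "\<sigma>V ` W \<subseteq> W \<Longrightarrow> \<sigma>V ` weight_part W h \<subseteq> weight_part W h"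
  by (auto simp: weight_part_def simp flip: \<sigma>V.scale) (metis \<sigma>V_Y \<sigma>V_\<omega>)

lemma invariants_subspace: "V.subspace W \<Longrightarrow> V.subspace (invariants W)"
  by (auto simp: invariants_def V.subspace_def current0.add current0.scale)

lemma invariants_stable: "V.subspace W \<Longrightarrow> stable_under (g_ops \<rho>V) (invariants W)"
  by (rule stable_g_opsI) (auto simp: invariants_def V.subspace_0)

lemma invariants_L0: "Y \<omega> 1 ` W \<subseteq> W \<Longrightarrow> Y \<omega> 1 ` invariants W \<subseteq> invariants W"
  by (auto simp: invariants_def simp flip: L0_current0)

text \<open>The vertex operator algebra is spanned by L(0)-eigenspaces, and stability under L(0)
  keeps the components of a vector of \<open>W\<close> inside \<open>W\<close>.\<close>

lemma weight_expansion:
  assumes W: "V.subspace W" "Y \<omega> 1 ` W \<subseteq> W" and v: "v \<in> W"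
  shows "\<exists>F w. finite F \<and> (\<forall>h\<in>F. w h \<in> weight_part W h) \<and> v = (\<Sum>h\<in>F. w h)"
proof -
  have "V.span (\<Union>h. weight_part UNIV h) = UNIV"
    using vertex_algebra(1) by (simp add: voa_def vir_def eigenspace_def weight_part_def)
  then have "v \<in> V.span (\<Union>h. weight_part UNIV h)" by simp
  from V.span_UN_subspaces[OF weight_part_subspace[OF V.subspace_UNIV] this]
  obtain F w where F: "finite F" "\<forall>h\<in>F. w h \<in> weight_part UNIV h" "v = (\<Sum>h\<in>F. w h)"
    by (elim exE conjE)
  have "\<forall>h\<in>F. w h \<in> W"
  proof (rule V.eigen_components_mem[OF W(1) Y.linear_axioms W(2) F(1)])
    show "inj_on (of_int :: int \<Rightarrow> complex) F" by (simp add: inj_on_def)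
  qed (use F v in \<open>auto simp: weight_part_def\<close>)
  then have "\<forall>h\<in>F. w h \<in> weight_part W h" using F(2) by (simp add: weight_part_def)
  then show ?thesis using F(1,3) by (intro exI conjI)
qed

lemma weight_part_nonzero:
  assumes W: "V.subspace W" "Y \<omega> 1 ` W \<subseteq> W" "W \<noteq> {0}"
  obtains h where "weight_part W h \<noteq> {0}"
proof -
  obtain v where v: "v \<in> W" "v \<noteq> 0" using W V.subspace_0 by blast
  obtain F w where F: "\<forall>h\<in>F. w h \<in> weight_part W h" "v = (\<Sum>h\<in>F. w h)"
    using weight_expansion[OF W(1,2) v(1)] by (elim exE conjE)
  from v(2) have "\<exists>h\<in>F. w h \<noteq> 0" unfolding F(2) by (meson sum.neutral)
  then show ?thesis using F(1) that by blast
qed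

text \<open>For \<open>x\<close> of degree \<open>p\<close>, the coefficient of x(0)r at
  \<open>n\<close> is the bracket of x(p/T) with the coefficient of \<open>r\<close> at n - p/T.
  This makes the vectors with all coefficients in \<open>U\<close> a \<gg>-submodule.\<close>

lemma current_coeff_mem:
  assumes U: "op.subspace U" and r: "killed_by_positive \<rho>V {r}"
    and comm: "\<And>x p n. x \<in> graded_part sg \<sigma> T p \<Longrightarrow> n \<in> frac_ints T \<Longrightarrow>
      commutator (\<rho>M (mode x (of_int p / of_nat T))) (YM r n) \<in> U"
  shows "YM (\<rho>V (mode x 0) r) n \<in> U"
proof (cases "n \<in> frac_ints T")
  case True
  have "YM (\<rho>V (mode x 0) r) n \<in> U" if x: "x \<in> graded_part sg \<sigma> T p" for x p
  proof -
    have n: "n - of_int p / of_nat T \<in> frac_ints T"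
      using True by (intro frac_ints_diff) simp_all
    show ?thesis
      using comm[OF x n] by (simp add: commutator_current_killed[OF x refl n r])
  qed
  then have "(\<Sum>j<T. YM (\<rho>V (mode (graded_proj sg \<sigma> T j x) 0) r) n) \<in> U"
    using U graded_proj_mem[OF \<sigma>.linear_axioms automorphism(2)] by (intro op.subspace_sum) blast+
  then show ?thesis
    using sum_current_proj[of x 0 r] by (simp flip: YM_left.sum)
next
  case False
  then show ?thesis using U op.subspace_0 by (simp add: YM_not_frac)
qed

section \<open>The loop module of an irreducible module\<close>

lemma nontrivial_irreducible_coeffs:
  assumes R: "V.subspace R" "\<sigma>V ` R \<subseteq> R" "Y \<omega> 1 ` R \<subseteq> R"
    and killed: "killed_by_positive \<rho>V R"
    and irr: "nontrivial_irreducible_under sV (g_ops \<rho>V) R" and nonzero: "coeffs R \<noteq> {0}"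
  shows "nontrivial_irreducible_under (op_scale sM) adj_ops (coeffs R)"
proof -
  have g: "stable_under (g_ops \<rho>V) R" and R0: "R \<noteq> {0}"
    and sub: "\<And>W. V.subspace W \<Longrightarrow> W \<subseteq> R \<Longrightarrow> stable_under (g_ops \<rho>V) W \<Longrightarrow> W = {0} \<or> W = R"
    and act: "acts_nontrivially (g_ops \<rho>V) R"
    using irr by (auto simp: nontrivial_irreducible_under_def irreducible_under_def)
  obtain x0 r0 where r0: "r0 \<in> R" "\<rho>V (mode x0 0) r0 \<noteq> 0"
    using act by (auto simp: acts_nontrivially_def g_ops_def)
  have killed1: "killed_by_positive \<rho>V {r}" if "r \<in> R" for r
    using killed that by (rule killed_singleton)
  \<comment> \<open>The invariants form a submodule, and \<open>r0\<close> is not among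
    them.\<close>
  have inv: "invariants R = {0}"
    using sub[OF invariants_subspace[OF R(1)] _ invariants_stable[OF R(1)]] r0
    by (auto simp: invariants_def)
  obtain h where "weight_part R h \<noteq> {0}" using weight_part_nonzero[OF R(1,3) R0] .
  \<comment> \<open>L(0) commutes with \<gg>, so a weight part is a submodule and L(0) acts on
    \<open>R\<close> by a scalar.\<close>
  then have "weight_part R h = R"
    using sub[OF weight_part_subspace[OF R(1)] _ weight_part_stable[OF g]] by (auto simp: weight_part_def)
  then have weight: "Y \<omega> 1 r = sV (of_int h) r" if "r \<in> R" for r
    using that by (auto simp: weight_part_def)
  \<comment> \<open>One nonzero vector \<open>s\<close> suffices, because the vectors of
    \<open>R\<close> with all coefficients in \<open>U\<close> form a submodule.\<close>
  have full: "coeffs R \<subseteq> U"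
    if U: "op.subspace U" and s: "s \<in> R" "s \<noteq> 0" "\<And>n. YM s n \<in> U"
      and closed: "\<And>x p z. x \<in> graded_part sg \<sigma> T p \<Longrightarrow> z \<in> U \<Longrightarrow>
        commutator (\<rho>M (mode x (of_int p / of_nat T))) z \<in> U" for U s
  proof -
    define S where "S = {r \<in> R. \<forall>n. YM r n \<in> U}"
    have "V.subspace S"
      using R(1) U by (auto simp: S_def V.subspace_def op.subspace_def YM_left.add YM_left.scale)
    moreover have "stable_under (g_ops \<rho>V) S"
      using current_coeff_mem[OF U killed1] closed
      by (intro stable_g_opsI) (simp add: S_def current0_mem[OF g])
    ultimately have "S = {0} \<or> S = R" by (intro sub) (auto simp: S_def)
    moreover have "s \<in> S" using s by (simp add: S_def)
    ultimately have "S = R" using s(2) by auto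
    then show ?thesis using U by (intro coeffs_minimal) (auto simp: S_def)
  qed
  have stable: "stable_under adj_ops (coeffs R)"
    by (rule coeffs_stable[OF R(1) g R(3) killed])
  have "U = {0} \<or> U = coeffs R"
    if U: "op.subspace U" "U \<subseteq> coeffs R" "stable_under adj_ops U" for U
  proof (cases "U = {0}")
    case False
    have closed: "commutator (\<rho>M (mode x (of_int p / of_nat T))) z \<in> U"
      if "x \<in> graded_part sg \<sigma> T p" "z \<in> U" for x p z
      using stable_under_adjoint_current[OF U(3) that(2,1)] .
    obtain w n where w: "w \<in> R" "n \<in> frac_ints T" "YM w n \<in> U" "YM w n \<noteq> 0"
      using coeffs_homogeneous_member[OF R(1) weight U(1,2) False stable_under_adjoint_L0[OF U(3)]]
      by blast
    obtain q where q: "n = of_int q / of_nat T" using w(2) by (auto simp: frac_ints_eq)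
    define u where "u = hom_part q w"
    have u: "u \<in> R" unfolding u_def by (rule hom_part_mem[OF R(1,2) w(1)])
    have YMu: "YM u n = YM w n" unfolding u_def by (rule YM_hom_part[OF q])
    have "u \<noteq> 0" using YMu w(4) by auto
    then have "u \<notin> invariants R" unfolding inv by simp
    then obtain x where x: "\<rho>V (mode x 0) u \<noteq> 0" using u by (auto simp: invariants_def)
    \<comment> \<open>With \<open>v = 0\<close> and \<open>d = 0\<close> the relation in
      \<open>current_shift\<close> is plain membership in \<open>U\<close>.\<close>
    have "YM (\<rho>V (mode x 0) u) n' - YM (\<rho>V (mode x 0) 0) (n' + of_int 0) \<in> U" for n'
    proof (rule current_shift[OF U(1) closed])
      show "u \<in> graded_part sV \<sigma>V T q" by (simp add: u_def hom_part_graded)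
      show "(0::'v) \<in> graded_part sV \<sigma>V T q" by (simp add: mem_graded_part)
      show "killed_by_positive \<rho>V {u}" "killed_by_positive \<rho>V {0}"
        using killed1 u V.subspace_0[OF R(1)] by blast+
      show "YM u (of_int q / of_nat T) - YM 0 (of_int q / of_nat T + of_int 0) \<in> U"
        using w(3) YMu by (simp add: q)
    qed
    then have "YM (\<rho>V (mode x 0) u) n' \<in> U" for n' by simp
    then have "coeffs R \<subseteq> U"
      by (rule full[OF U(1) current0_mem[OF g u] x _ closed])
    then show ?thesis using U(2) by blast
  qed simp
  then have "irreducible_under (op_scale sM) adj_ops (coeffs R)"
    using stable nonzero coeffs_subspace by (auto simp: irreducible_under_def)
  moreover have "acts_nontrivially adj_ops (coeffs R)"
  proof (rule ccontr)
    \<comment> \<open>Under a zero adjoint action all coefficients of x0(0)r0 vanish;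
      \<open>full\<close> for the zero subspace then makes the whole coefficient space zero.\<close>
    assume triv: "\<not> acts_nontrivially adj_ops (coeffs R)"
    have "commutator (\<rho>M (mode x (of_int p / of_nat T))) z = 0"
      if "x \<in> graded_part sg \<sigma> T p" and z: "z \<in> coeffs R" for x p z
      using triv z current_mem_adjoint_ops[OF that(1)] by (auto simp: acts_nontrivially_def)
    then have "YM (\<rho>V (mode x0 0) r0) n \<in> {0}" for n
      using coeff_mem[OF r0(1)] by (intro current_coeff_mem killed1 r0) auto
    moreover have "commutator X z \<in> {0}" if "Vector_Spaces.linear sM sM X" "z \<in> {0}" for X z
    proof -
      interpret Vector_Spaces.linear "op_scale sM" "op_scale sM" "commutator X"
        by (rule linear_commutator[OF that(1)])
      show ?thesis using that(2) by simp
    qed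
    ultimately have "coeffs R \<subseteq> {0}"
      using r0(2)
      by (intro full[OF op.subspace_single_0 current0_mem[OF g r0(1)]]) (blast intro: M_linear mode_mem_M)+
    then show False
      using nonzero op.subspace_0[OF coeffs_subspace] by auto
  qed
  ultimately show ?thesis by (simp add: nontrivial_irreducible_under_def)
qed

section \<open>The converse for faithful modules\<close>

text \<open>L(-1)r = 0 leaves only the coefficient at -1 in the field of \<open>r\<close>. Its
  commutator with L(0) is therefore 0, and applying this to the vacuum gives L(0)r = 0.\<close>

lemma translation_invariant_weight_0:
  assumes "Y \<omega> 0 r = 0"
  shows "Y \<omega> 1 r = 0"
proof -
  have const: "Y r n v = 0" if "n \<noteq> -1" for n v
  proof -
    have "sV (- of_int (n + 1)) (Y r n v) = 0"
      using translation_Y[of r "n + 1" v] assms by simp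
    moreover have "(- of_int (n + 1) :: complex) \<noteq> 0"
      using that by (metis add_eq_0_iff2 neg_equal_0_iff_equal of_int_eq_0_iff)
    ultimately show ?thesis by (simp only: V.scale_eq_0_iff) simp
  qed
  have "Y r (-1) (Y \<omega> 1 vac) - Y \<omega> 1 (Y r (-1) vac)
      = Sum_any (\<lambda>i. sV (of_int (- 1) gchoose i) (Y (Y r (int i) \<omega>) (-1 + 1 - int i) vac))"
    by (rule commutator_Y)
  also have "\<dots> = 0" by (simp add: const)
  finally show ?thesis by (simp add: vacuum_Y)
qed

text \<open>If \<gg> annihilated \<open>R\<close>, a nonzero coefficient of a weight vector
  \<open>r\<close> would span a submodule, hence everything. Then ad L(0) leaves a single exponent,
  L(-1) forces it to be -1, and faithfulness yields L(-1)r = 0, so L(0)r = 0 and the adjoint action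
  is zero.\<close>

lemma acts_nontrivially_of_coeffs:
  assumes R: "V.subspace R" "Y \<omega> 1 ` R \<subseteq> R" and killed: "killed_by_positive \<rho>V R"
    and faithful: "faithful YM"
    and irr: "nontrivial_irreducible_under (op_scale sM) adj_ops (coeffs R)"
  shows "acts_nontrivially (g_ops \<rho>V) R"
proof (rule ccontr)
  assume "\<not> acts_nontrivially (g_ops \<rho>V) R"
  then have triv: "\<rho>V (mode x 0) r = 0" if "r \<in> R" for x r
    using that by (auto simp: acts_nontrivially_def g_ops_def)
  have nonzero: "coeffs R \<noteq> {0}" and act: "acts_nontrivially adj_ops (coeffs R)"
    and sub: "\<And>U. op.subspace U \<Longrightarrow> U \<subseteq> coeffs R \<Longrightarrow> stable_under adj_ops U \<Longrightarrow> U = {0} \<or> U = coeffs R"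
    using irr by (auto simp: nontrivial_irreducible_under_def irreducible_under_def)
  have "\<exists>r\<in>R. \<exists>n\<in>frac_ints T. YM r n \<noteq> 0"
  proof (rule ccontr)
    assume "\<not> ?thesis"
    then have "coeffs R \<subseteq> {0}" by (intro coeffs_minimal op.subspace_single_0) auto
    then show False using nonzero op.subspace_0[OF coeffs_subspace] by auto
  qed
  then obtain r' n where r': "r' \<in> R" and n: "n \<in> frac_ints T" and "YM r' n \<noteq> 0" by blast
  moreover obtain F w where F: "\<forall>h\<in>F. w h \<in> weight_part R h" "r' = (\<Sum>h\<in>F. w h)"
    using weight_expansion[OF R r'] by (elim exE conjE)
  ultimately have "(\<Sum>h\<in>F. YM (w h) n) \<noteq> 0" by (simp add: YM_left.sum)
  then obtain h where "h \<in> F" "YM (w h) n \<noteq> 0" by (meson sum.neutral)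
  then obtain r where r: "r \<in> R" "Y \<omega> 1 r = sV (of_int h) r" "YM r n \<noteq> 0"
    using F(1) by (auto simp: weight_part_def)
  let ?u = "YM r n"
  have adj: "commutator (\<rho>M (f, \<alpha>, 0) - op_scale sM \<beta> (YM \<omega> 1)) ?u
      = op_scale sM (- \<beta>) (YM (Y \<omega> 1 r) n - op_scale sM (of_rat n + 1) ?u)"
    if "(f, \<alpha>, \<beta>) \<in> twisted_affine sg \<sigma> T" for f \<alpha> \<beta>
    unfolding commutator_adjoint[OF that n killed_singleton[OF killed r(1)]]
    by (simp add: triv[OF r(1)])
  have "stable_under adj_ops (op.span {?u})"
    unfolding stable_under_def adjoint_ops_def
  proof (clarsimp simp: image_subset_iff)
    fix f \<alpha> \<beta> z assume X: "(f, \<alpha>, \<beta>) \<in> twisted_affine sg \<sigma> T" and z: "z \<in> op.span {?u}"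
    interpret A: Vector_Spaces.linear "op_scale sM" "op_scale sM"
      "commutator (\<rho>M (f, \<alpha>, 0) - op_scale sM \<beta> (YM \<omega> 1))"
      by (rule adjoint_operator_linear[OF X])
    have u: "?u \<in> op.span {?u}" by (simp add: op.span_base)
    have "op.span {?u} \<subseteq> {z. commutator (\<rho>M (f, \<alpha>, 0) - op_scale sM \<beta> (YM \<omega> 1)) z \<in> op.span {?u}}"
    proof (intro op.span_minimal A.subspace_linear_preimage op.subspace_span)
      have "commutator (\<rho>M (f, \<alpha>, 0) - op_scale sM \<beta> (YM \<omega> 1)) ?u \<in> op.span {?u}"
        unfolding adj[OF X] r(2) YM_left.scale by (intro op.span_scale op.span_diff u)
      then show "{?u} \<subseteq> {z. commutator (\<rho>M (f, \<alpha>, 0) - op_scale sM \<beta> (YM \<omega> 1)) z \<in> op.span {?u}}"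
        by simp
    qed
    then show "commutator (\<rho>M (f, \<alpha>, 0) - op_scale sM \<beta> (YM \<omega> 1)) z \<in> op.span {?u}"
      using z by blast
  qed
  moreover have "op.span {?u} \<subseteq> coeffs R"
    using coeff_mem[OF r(1) n] by (intro op.span_minimal coeffs_subspace) simp
  moreover have "op.span {?u} \<noteq> {0}" using r(3) op.span_base[of ?u "{?u}"] by auto
  ultimately have span: "coeffs R = op.span {?u}" using sub by blast
  \<comment> \<open>The coefficient at \<open>n'\<close> is a multiple of the one at
    \<open>n\<close>, but the two ad L(0)-eigenvalues differ.\<close>
  have other: "YM r n' = 0" if "n' \<noteq> n" for n'
  proof (cases "n' \<in> frac_ints T")
    case True
    then have "YM r n' \<in> op.span {?u}" using coeff_mem[OF r(1)] span by blast
    then obtain c where c: "YM r n' = op_scale sM c ?u" by (auto simp: op.span_singleton)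
    interpret L: Vector_Spaces.linear "op_scale sM" "op_scale sM" "commutator (YM \<omega> 1)"
      by (rule commutator_\<omega>_linear)
    have "op_scale sM (of_int h - 1 - of_rat n') (YM r n') = op_scale sM (of_int h - 1 - of_rat n) (YM r n')"
      using commutator_L0_eigen[OF r(2) True] commutator_L0_eigen[OF r(2) n]
      by (simp add: c L.scale mult.commute eq_commute[of n n'])
    then show ?thesis using that by (simp only: op.scale_cancel_right) simp
  qed (simp add: YM_not_frac)
  \<comment> \<open>Bracketing L(-1) with the vanishing coefficient at \<open>n + 1\<close> gives
    \<open>- (n + 1)\<close> times the nonzero coefficient at \<open>n\<close>.\<close>
  have "n = -1"
  proof -
    have "op_scale sM (- of_rat (n + 1)) (YM r (n + 1 - 1)) = commutator (YM \<omega> 0) (YM r (n + 1))"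
      using n by (intro commutator_translation[symmetric] frac_ints_add) simp_all
    also have "\<dots> = 0" using other[of "n + 1"] by (simp add: commutator_def fun_eq_iff)
    finally have "of_rat (n + 1) = (0 :: complex)" using r(3) by simp
    then show ?thesis by (simp add: eq_neg_iff_add_eq_0 del: of_rat_add)
  qed
  have "Y \<omega> 0 r = 0"
  proof (rule faithful_eq_0[OF faithful])
    fix n' assume "n' \<in> frac_ints T"
    \<comment> \<open>At \<open>n' = 0\<close> the factor in the translation formula is 0; elsewhere
      \<open>n' - 1\<close> differs from \<open>n = -1\<close>.\<close>
    show "YM (Y \<omega> 0 r) n' = 0"
      using other[of "n' - 1"] \<open>n = -1\<close> by (cases "n' = 0") (simp_all add: translation_YM)
  qed
  then have "Y \<omega> 1 r = 0" by (rule translation_invariant_weight_0)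
  then have adj_0: "commutator (\<rho>M (f, \<alpha>, 0) - op_scale sM \<beta> (YM \<omega> 1)) ?u = 0"
    if "(f, \<alpha>, \<beta>) \<in> twisted_affine sg \<sigma> T" for f \<alpha> \<beta>
    using adj[OF that] \<open>n = -1\<close> by simp
  obtain A z where A: "A \<in> adj_ops" "z \<in> coeffs R" "A z \<noteq> 0"
    using act by (auto simp: acts_nontrivially_def)
  then obtain f \<alpha> \<beta> where X: "(f, \<alpha>, \<beta>) \<in> twisted_affine sg \<sigma> T"
    and A_eq: "A = commutator (\<rho>M (f, \<alpha>, 0) - op_scale sM \<beta> (YM \<omega> 1))"
    by (auto simp: adjoint_ops_def)
  interpret A: Vector_Spaces.linear "op_scale sM" "op_scale sM" A
    unfolding A_eq by (rule adjoint_operator_linear[OF X])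
  obtain c where "z = op_scale sM c ?u" using A(2) unfolding span op.span_singleton by blast
  then have "A z = op_scale sM c (A ?u)" by (simp only: A.scale)
  then show False using A(3) adj_0[OF X] by (simp add: A_eq)
qed

text \<open>Once a nonzero submodule is known to have the full coefficient space, comparing
  coefficients after applying x(0) determines homogeneous vectors up to invariants, and these are 0.
  Homogeneous parts have to stay inside the submodule, whence \<open>\<sigma>V\<close> among the
  operators.\<close>

lemma irreducible_of_coeffs:
  assumes R: "V.subspace R" "\<sigma>V ` R \<subseteq> R" "stable_under (g_ops \<rho>V) R" "Y \<omega> 1 ` R \<subseteq> R"
    and killed: "killed_by_positive \<rho>V R" and faithful: "faithful YM"
    and irr: "nontrivial_irreducible_under (op_scale sM) adj_ops (coeffs R)"
  shows "irreducible_under sV (insert \<sigma>V (g_ops \<rho>V)) R"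
proof -
  have nonzero: "coeffs R \<noteq> {0}"
    and sub: "\<And>U. op.subspace U \<Longrightarrow> U \<subseteq> coeffs R \<Longrightarrow> stable_under adj_ops U \<Longrightarrow> U = {0} \<or> U = coeffs R"
    using irr by (auto simp: nontrivial_irreducible_under_def irreducible_under_def)
  have killed1: "killed_by_positive \<rho>V {r}" if "r \<in> R" for r
    using killed that by (rule killed_singleton)
  have R0: "R \<noteq> {0}"
  proof
    assume "R = {0}"
    then have "coeffs R \<subseteq> {0}" by (intro coeffs_minimal op.subspace_single_0) auto
    then show False using nonzero op.subspace_0[OF coeffs_subspace] by auto
  qed
  \<comment> \<open>Faithfulness excludes a zero coefficient space for
    \<open>W \<noteq> {0}\<close>, and irreducibility leaves only the whole space.\<close>
  have full: "W = {0} \<or> coeffs W = coeffs R"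
    if W: "V.subspace W" "W \<subseteq> R" "stable_under (g_ops \<rho>V) W" "Y \<omega> 1 ` W \<subseteq> W" for W
  proof (cases "coeffs W = {0}")
    case True
    then have "w = 0" if "w \<in> W" for w
      using coeff_mem[OF that] by (intro faithful_eq_0[OF faithful]) auto
    then show ?thesis using V.subspace_0[OF W(1)] by blast
  next
    case False
    have "stable_under adj_ops (coeffs W)"
      by (rule coeffs_stable[OF W(1,3,4) killed_mono[OF killed W(2)]])
    then show ?thesis
      using sub[OF coeffs_subspace coeffs_mono[OF W(2)]] False by blast
  qed
  obtain x0 r0 where r0: "r0 \<in> R" "\<rho>V (mode x0 0) r0 \<noteq> 0"
    using acts_nontrivially_of_coeffs[OF R(1,4) killed faithful irr]
    by (auto simp: acts_nontrivially_def g_ops_def)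
  \<comment> \<open>Nonzero invariants would supply all of \<open>coeffs R\<close>; then every
    bracket with a current is 0, and faithfulness gives x0(0)r0 = 0.\<close>
  have inv: "invariants R = {0}"
  proof (rule ccontr)
    let ?I = "invariants R"
    assume "?I \<noteq> {0}"
    moreover have IR: "?I \<subseteq> R" by (auto simp: invariants_def)
    ultimately have eq: "coeffs ?I = coeffs R"
      using full[OF invariants_subspace[OF R(1)] IR invariants_stable[OF R(1)] invariants_L0[OF R(4)]]
      by blast
    have "commutator (\<rho>M (mode x (of_int p / of_nat T))) z = 0"
      if x: "x \<in> graded_part sg \<sigma> T p" and z: "z \<in> coeffs R" for x p z
    proof -
      interpret c: Vector_Spaces.linear "op_scale sM" "op_scale sM"
        "commutator (\<rho>M (mode x (of_int p / of_nat T)))"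
        by (intro linear_commutator M_linear mode_mem_M x)
      have "coeffs ?I \<subseteq> {z. commutator (\<rho>M (mode x (of_int p / of_nat T))) z = 0}"
      proof (intro coeffs_minimal c.subspace_kernel CollectI)
        fix r n assume r: "r \<in> ?I" and n: "n \<in> frac_ints T"
        then have "r \<in> R" using IR by blast
        show "commutator (\<rho>M (mode x (of_int p / of_nat T))) (YM r n) = 0"
          using r unfolding commutator_current_killed[OF x refl n killed1[OF \<open>r \<in> R\<close>]]
          by (simp add: invariants_def)
      qed
      then show ?thesis using z eq by blast
    qed
    then have "YM (\<rho>V (mode x0 0) r0) n \<in> {0}" for n
      using coeff_mem[OF r0(1)] by (intro current_coeff_mem killed1 r0 op.subspace_single_0) auto
    then have "\<rho>V (mode x0 0) r0 = 0" by (intro faithful_eq_0[OF faithful]) simp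
    then show False using r0(2) by simp
  qed
  have hom_nonzero: "\<exists>j. hom_part j v \<noteq> 0" if "v \<noteq> 0" for v
  proof -
    have "(\<Sum>j<T. hom_part (int j) v) \<noteq> 0" using that by (simp add: sum_hom_part)
    then show ?thesis by (meson sum.neutral)
  qed
  \<comment> \<open>This is \<open>current_shift\<close> for the zero subspace, where membership of
    a difference means equality.\<close>
  have shift: "YM (\<rho>V (mode x 0) u) n = YM (\<rho>V (mode x 0) v) (n + of_int d)"
    if u: "u \<in> R" "u \<in> graded_part sV \<sigma>V T q" and v: "v \<in> R" "v \<in> graded_part sV \<sigma>V T q"
      and eq: "YM u (of_int q / of_nat T) = YM v (of_int q / of_nat T + of_int d)" for u v q d x n
  proof -
    have "commutator (\<rho>M (mode x (of_int p / of_nat T))) z \<in> {0}"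
      if "x \<in> graded_part sg \<sigma> T p" "z \<in> {0}" for x p z
    proof -
      interpret c: Vector_Spaces.linear "op_scale sM" "op_scale sM"
        "commutator (\<rho>M (mode x (of_int p / of_nat T)))"
        by (intro linear_commutator M_linear mode_mem_M that)
      show ?thesis using that(2) by simp
    qed
    then have "YM (\<rho>V (mode x 0) u) n - YM (\<rho>V (mode x 0) v) (n + of_int d) \<in> {0}"
      by (rule current_shift[OF op.subspace_single_0 _ u(2) killed1[OF u(1)] v(2) killed1[OF v(1)]])
         (simp_all add: eq)
    then show ?thesis by simp
  qed
  have weight_full: "coeffs (weight_part R h) = coeffs R" if "weight_part R h \<noteq> {0}" for h
    using full[OF weight_part_subspace[OF R(1)] _ weight_part_stable[OF R(3)] weight_part_L0[OF R(1)]] that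
    by (auto simp: weight_part_def)
  obtain h0 where h0: "weight_part R h0 \<noteq> {0}" using weight_part_nonzero[OF R(1,4) R0] .
  have unique: "h = h0" if h: "weight_part R h \<noteq> {0}" for h
  proof (rule ccontr)
    assume "h \<noteq> h0"
    \<comment> \<open>Shifting the exponent by \<open>d\<close> compensates the difference of
      weights: \<open>h - 1 - n = h0 - 1 - (n + d)\<close>.\<close>
    define d where "d = h0 - h"
    note sub_h = weight_part_subspace[OF R(1), of h] and sub_h0 = weight_part_subspace[OF R(1), of h0]
    obtain r where r: "r \<in> weight_part R h" "r \<noteq> 0" using h V.subspace_0[OF sub_h] by blast
    obtain j where j: "hom_part j r \<noteq> 0" using hom_nonzero[OF r(2)] by blast
    define u where "u = hom_part j r"
    have u: "u \<in> weight_part R h"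
      unfolding u_def by (rule hom_part_mem[OF sub_h weight_part_\<sigma>V[OF R(2)] r(1)])
    define n where "n = (of_int j / of_nat T :: rat)"
    have n: "n \<in> frac_ints T" by (simp add: n_def)
    have "YM u n \<in> coeffs (weight_part R h0)"
      using coeff_mem[OF u n] weight_full[OF h] weight_full[OF h0] by simp
    moreover have "commutator (YM \<omega> 1) (YM u n) = op_scale sM (of_int h0 - 1 - of_rat (n + of_int d)) (YM u n)"
      using commutator_L0_eigen[of u "of_int h" n] u n by (simp add: weight_part_def d_def of_rat_add of_rat_diff)
    ultimately obtain v' where v': "v' \<in> weight_part R h0" "YM u n = YM v' (n + of_int d)"
      using coeffs_eigenvector[OF sub_h0, of "of_int h0" "YM u n" "n + of_int d"] weight_partD by blast
    define v where "v = hom_part j v'"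
    have v: "v \<in> weight_part R h0"
      unfolding v_def by (rule hom_part_mem[OF sub_h0 weight_part_\<sigma>V[OF R(2)] v'(1)])
    \<comment> \<open>An integral shift of the exponent calls for the same homogeneous degree, so
      \<open>v\<close> is taken in degree \<open>j\<close> as well.\<close>
    have "n + of_int d = of_int (j + d * int T) / of_nat T" by (simp add: n_def field_simps)
    then have "YM (hom_part (j + d * int T) v') (n + of_int d) = YM v' (n + of_int d)"
      by (rule YM_hom_part)
    moreover have "hom_part (j + d * int T) v' = v" by (simp add: v_def hom_part_def)
    ultimately have eq: "YM u n = YM v (n + of_int d)" using v'(2) by simp
    have "\<rho>V (mode x 0) u = 0" for x
    proof (rule faithful_eq_0[OF faithful])
      fix n' assume n': "n' \<in> frac_ints T"
      let ?xu = "\<rho>V (mode x 0) u" and ?xv = "\<rho>V (mode x 0) v"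
      have xs: "YM ?xu m = YM ?xv (m + of_int d)" for m
        using u v eq by (intro shift[where q = j]) (auto simp: weight_part_def n_def u_def v_def hom_part_graded)
      \<comment> \<open>L(-1) produces the same operator with factor \<open>- (n' + 1)\<close> from
        \<open>u\<close> and with factor \<open>- (n' + 1 + d)\<close> from \<open>v\<close>; since
        \<open>d \<noteq> 0\<close>, that operator is 0.\<close>
      have "op_scale sM (- of_rat (n' + 1)) (YM ?xu n') = commutator (YM \<omega> 0) (YM ?xu (n' + 1))"
        using commutator_translation[of "n' + 1" ?xu] n' by (simp add: frac_ints_add)
      also have "\<dots> = commutator (YM \<omega> 0) (YM ?xv (n' + 1 + of_int d))"
        by (simp only: xs)
      also have "\<dots> = op_scale sM (- of_rat (n' + 1 + of_int d)) (YM ?xv (n' + 1 + of_int d - 1))"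
        using n' by (intro commutator_translation frac_ints_add) simp_all
      also have "YM ?xv (n' + 1 + of_int d - 1) = YM ?xu n'" by (simp add: xs)
      finally show "YM ?xu n' = 0"
        using \<open>h \<noteq> h0\<close> by (simp add: of_rat_add d_def)
    qed
    then have "u \<in> invariants R" using u by (simp add: invariants_def weight_part_def)
    then show False using inv j by (simp add: u_def)
  qed
  have weight: "Y \<omega> 1 r = sV (of_int h0) r" if r: "r \<in> R" for r
  proof -
    obtain F w where F: "\<forall>h\<in>F. w h \<in> weight_part R h" "r = (\<Sum>h\<in>F. w h)"
      using weight_expansion[OF R(1,4) r] by (elim exE conjE)
    have "Y \<omega> 1 (w h) = sV (of_int h0) (w h)" if "h \<in> F" for h
      using F(1) that unique[of h] by (cases "w h = 0") (auto simp: weight_part_def)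
    then show ?thesis by (simp add: F(2) Y.sum V.scale_sum_right)
  qed
  have "W = {0} \<or> W = R"
    if W: "V.subspace W" "W \<subseteq> R" "stable_under (insert \<sigma>V (g_ops \<rho>V)) W" for W
  proof (cases "W = {0}")
    case False
    have W\<sigma>: "\<sigma>V ` W \<subseteq> W" and Wg: "stable_under (g_ops \<rho>V) W"
      using W(3) by (auto simp: stable_under_def)
    have W0: "Y \<omega> 1 ` W \<subseteq> W"
      using weight W(1,2) by (auto simp: subset_iff V.subspace_scale)
    have eq: "coeffs W = coeffs R" using full[OF W(1,2) Wg W0] False by blast
    have "r \<in> W" if r: "r \<in> R" for r
    proof -
      have "hom_part j r \<in> W" for j
      proof -
        define u where "u = hom_part j r"
        have u: "u \<in> R" unfolding u_def by (rule hom_part_mem[OF R(1,2) r])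
        define n where "n = (of_int j / of_nat T :: rat)"
        have n: "n \<in> frac_ints T" by (simp add: n_def)
        have "YM u n \<in> coeffs W" using coeff_mem[OF u n] eq by simp
        moreover have "commutator (YM \<omega> 1) (YM u n) = op_scale sM (of_int h0 - 1 - of_rat n) (YM u n)"
          by (rule commutator_L0_eigen[OF weight[OF u] n])
        \<comment> \<open>L(0) is a scalar on \<open>W\<close>, so this eigenvector is a single
          coefficient of a vector of \<open>W\<close>, at the same exponent.\<close>
        ultimately obtain w' where w': "w' \<in> W" "YM u n = YM w' n"
          using W(2) weight by (rule_tac coeffs_eigenvector[OF W(1)]) auto
        define w where "w = hom_part j w'"
        have w: "w \<in> W" unfolding w_def by (rule hom_part_mem[OF W(1) W\<sigma> w'(1)])
        have "YM u n = YM w n" using w'(2) YM_hom_part[OF n_def] by (simp add: w_def)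
        then have xs: "YM (\<rho>V (mode x 0) u) m = YM (\<rho>V (mode x 0) w) (m + of_int 0)" for x m
          using u w W(2)
          by (intro shift[where q = j]) (auto simp: n_def u_def w_def hom_part_graded)
        \<comment> \<open>Equality of all coefficients of x(0)u and x(0)w makes \<open>u - w\<close>
          an invariant, hence 0.\<close>
        have "\<rho>V (mode x 0) (u - w) = 0" for x
          using xs by (intro faithful_eq_0[OF faithful]) (simp add: current0.diff YM_left.diff)
        then have "u - w \<in> invariants R"
          using u w W(2) R(1) by (auto simp: invariants_def intro: V.subspace_diff)
        then show ?thesis using inv w by (simp add: u_def)
      qed
      then have "(\<Sum>j<T. hom_part (int j) r) \<in> W" by (intro V.subspace_sum W(1))
      then show ?thesis by (simp add: sum_hom_part)
    qed
    then show ?thesis using W(2) by blast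
  qed simp
  then show ?thesis
    using R R0 by (auto simp: irreducible_under_def stable_under_def)
qed

end

text \<open>For \<open>M = 0\<close> all coefficients vanish, which is why the forward half of (ii)
  asks for a nonzero coefficient space. Its converse gives irreducibility under \<gg> together with
  \<sigma>, and under \<gg> alone when \<sigma> preserves every \<gg>-submodule of
  \<open>R\<close>.\<close>

theorem theorem2p1:
  fixes sg :: "complex \<Rightarrow> 'g::ab_group_add \<Rightarrow> 'g"
    and br :: "'g \<Rightarrow> 'g \<Rightarrow> 'g"
    and form :: "'g \<Rightarrow> 'g \<Rightarrow> complex"
    and H D B :: "'g set"
    and \<sigma> :: "'g \<Rightarrow> 'g"
    and T :: nat
    and k :: complex
    and sV :: "complex \<Rightarrow> 'v::ab_group_add \<Rightarrow> 'v"
    and \<rho>V :: "'g affine \<Rightarrow> 'v \<Rightarrow> 'v"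
    and Y :: "'v \<Rightarrow> int \<Rightarrow> 'v \<Rightarrow> 'v"
    and vac \<omega> :: 'v
    and \<sigma>V :: "'v \<Rightarrow> 'v"
    and sM :: "complex \<Rightarrow> 'm::ab_group_add \<Rightarrow> 'm"
    and \<rho>M :: "'g affine \<Rightarrow> 'm \<Rightarrow> 'm"
    and YM :: "'v \<Rightarrow> rat \<Rightarrow> 'm \<Rightarrow> 'm"
    and R :: "'v set"
  assumes simple: "simple_lie_algebra sg br"
    and form: "invariant_form sg br form"
    and cartan: "cartan_subalgebra sg br H"
    and normalized: "long_roots_normalized sg br form H"
    and root_base: "root_base sg br form H D"
    and orthonormal: "orthonormal_basis sg form B"
    and \<sigma>: "lie_automorphism sg br \<sigma>" "has_order \<sigma> T"
    and noncritical: "k \<noteq> - dual_coxeter sg br form H D"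
    and N: "is_vacuum_module sg br form k sV \<rho>V vac"
    and \<omega>: "\<omega> = sugawara k (dual_coxeter sg br form H D) B sV \<rho>V vac"
    and Y: "voa sV Y vac \<omega>" "extends_currents \<rho>V vac Y"
    and \<sigma>V: "induced_automorphism \<sigma> sV \<rho>V vac \<sigma>V"
    and M: "restricted_module sg br form \<sigma> T k sM \<rho>M"
    and YM: "weak_twisted_module sV Y vac \<omega> \<sigma>V T sM YM"
            "extends_twisted_currents sg \<sigma> T \<rho>V vac \<rho>M YM"
    and R: "module.subspace sV R" "\<sigma>V ` R \<subseteq> R" "stable_under (g_ops \<rho>V) R"
           "vir Y \<omega> 0 ` R \<subseteq> R"
  shows
    "(killed_by_positive \<rho>V R \<longrightarrow>
        loop_formula sg \<sigma> T \<rho>V \<rho>M YM R \<and> loop_module sg \<sigma> T \<rho>V sM \<rho>M YM \<omega> R)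
     \<and> (faithful YM \<and> loop_formula sg \<sigma> T \<rho>V \<rho>M YM R \<longrightarrow> killed_by_positive \<rho>V R)
     \<and> (killed_by_positive \<rho>V R \<and> nontrivial_irreducible_under sV (g_ops \<rho>V) R
          \<and> coeff_space sM YM T R \<noteq> {0} \<longrightarrow>
        irreducible_loop_module sg \<sigma> T \<rho>V sM \<rho>M YM \<omega> R)
     \<and> (faithful YM \<and> irreducible_loop_module sg \<sigma> T \<rho>V sM \<rho>M YM \<omega> R \<longrightarrow>
        irreducible_under sV (insert \<sigma>V (g_ops \<rho>V)) R \<and> acts_nontrivially (g_ops \<rho>V) R
        \<and> ((\<forall>W. module.subspace sV W \<and> W \<subseteq> R \<and> stable_under (g_ops \<rho>V) W \<longrightarrow> \<sigma>V ` W \<subseteq> W) \<longrightarrow>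
             nontrivial_irreducible_under sV (g_ops \<rho>V) R))"
proof -
  have V_module: "lie_module (aff_scale sg) (aff_bracket sg br form) (twisted_affine sg id 1) sV \<rho>V"
    using N by (simp add: is_vacuum_module_def induced_module_def)
  have M_module: "lie_module (aff_scale sg) (aff_bracket sg br form) (twisted_affine sg \<sigma> T) sM \<rho>M"
    and level: "\<rho>M aff_c = sM k"
    using M by (auto simp: restricted_module_def)
  interpret twisted_current_module sg br form B \<sigma> T k "dual_coxeter sg br form H D"
    sV \<rho>V Y vac \<omega> \<sigma>V sM \<rho>M YM
    using simple form orthonormal \<sigma> V_module \<omega> Y \<sigma>V M_module level YM
    by unfold_locales (simp_all add: simple_lie_algebra_def)
  have R_L0: "Y \<omega> 1 ` R \<subseteq> R" using R(4) by (simp add: vir_def)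
  have loop: "loop_module sg \<sigma> T \<rho>V sM \<rho>M YM \<omega> R" if "killed_by_positive \<rho>V R"
    using coeffs_stable[OF R(1,3) R_L0 that] loop_formula_of_killed[OF that]
    by (simp add: loop_module_def)
  have 1: "killed_by_positive \<rho>V R \<longrightarrow>
      loop_formula sg \<sigma> T \<rho>V \<rho>M YM R \<and> loop_module sg \<sigma> T \<rho>V sM \<rho>M YM \<omega> R"
    using loop loop_formula_of_killed by blast
  have 2: "faithful YM \<and> loop_formula sg \<sigma> T \<rho>V \<rho>M YM R \<longrightarrow> killed_by_positive \<rho>V R"
    using killed_of_loop_formula by blast
  have 3: "killed_by_positive \<rho>V R \<and> nontrivial_irreducible_under sV (g_ops \<rho>V) R
      \<and> coeff_space sM YM T R \<noteq> {0} \<longrightarrow> irreducible_loop_module sg \<sigma> T \<rho>V sM \<rho>M YM \<omega> R"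
    using nontrivial_irreducible_coeffs[OF R(1,2) R_L0] loop
    by (simp add: irreducible_loop_module_def)
  have 4: "irreducible_under sV (insert \<sigma>V (g_ops \<rho>V)) R \<and> acts_nontrivially (g_ops \<rho>V) R
      \<and> ((\<forall>W. module.subspace sV W \<and> W \<subseteq> R \<and> stable_under (g_ops \<rho>V) W \<longrightarrow> \<sigma>V ` W \<subseteq> W) \<longrightarrow>
           nontrivial_irreducible_under sV (g_ops \<rho>V) R)"
    if f: "faithful YM" and irr: "irreducible_loop_module sg \<sigma> T \<rho>V sM \<rho>M YM \<omega> R"
  proof -
    \<comment> \<open>The loop formula is part of being a loop module, so the converse half of (i)
      applies.\<close>
    have killed: "killed_by_positive \<rho>V R"
      using irr 2 f by (simp add: irreducible_loop_module_def loop_module_def)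
    have irr': "nontrivial_irreducible_under (op_scale sM) adj_ops (coeffs R)"
      using irr by (simp add: irreducible_loop_module_def)
    have "irreducible_under sV (insert \<sigma>V (g_ops \<rho>V)) R"
      by (rule irreducible_of_coeffs[OF R(1-3) R_L0 killed f irr'])
    moreover have "acts_nontrivially (g_ops \<rho>V) R"
      by (rule acts_nontrivially_of_coeffs[OF R(1) R_L0 killed f irr'])
    ultimately show ?thesis
      unfolding nontrivial_irreducible_under_def irreducible_under_def stable_under_def by blast
  qed
  show ?thesis using 1 2 3 4 by blast
qed

end
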